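(* Let $q=p^{h}$ be a prime power with $q \equiv 5 \pmod{12}$ or $q\equiv 9 \pmod{12}$. Then the point set of the hyperbolic quadric $\mathcal{Q}^{+}(5,q)$ can be written as a disjoint union $\pi_{1} \cup \pi_{2} \cup \mathcal{T}_{1} \cup \mathcal{T}_{2}$, where $\pi_{1}$ and $\pi_{2}$ are (disjoint) generators of $\mathcal{Q}^{+}(5,q)$ and $\mathcal{T}_{1}$, $\mathcal{T}_{2}$ are $\frac{1}{2}(q^{2}-1)$-tight sets of $\mathcal{Q}^{+}(5,q)$ that are isomorphic, i.e. some collineation of $\mathcal{Q}^{+}(5,q)$ maps $\mathcal{T}_{1}$ onto $\mathcal{T}_{2}$.
   Context: $\mathcal{Q}^{+}(5,q)$ is the hyperbolic quadric in $\mathrm{PG}(5,q)$ (nondegenerate quadric of maximal Witt index $3$); its generators are the planes contained in it. For a point $\bm{p}$ of the quadric, $\bm{p}^{\perp}$ denotes the set of points of the quadric collinear with $\bm{p}$ (on a line contained in the quadric), including $\bm{p}$ itself. A set $\mathcal{T}$ of points of $\mathcal{Q}^{+}(5,q)$ is an $x$-tight set if for every point $\bm{p}$ of $\mathcal{Q}^{+}(5,q)$ one has $|\bm{p}^{\perp}\cap\mathcal{T}| = x(q+1) + q^{2}\bm{c}_{\mathcal{T}}(\bm{p})$, where $\bm{c}_{\mathcal{T}}$ is the characteristic function of $\mathcal{T}$. *)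

theory Defs
  imports "HOL-Analysis.Cartesian_Space" "HOL-Number_Theory.Cong"
begin

text \<open>
  Projective subspaces are represented by their sets of points, and a point is a
  one-dimensional linear subspace of the underlying vector space.
\<close>

definition pg_points :: "('a::field ^ 'n) set set" where
  "pg_points = {P. vec.subspace P \<and> vec.dim P = 1}"

definition pg_subspaces :: "nat \<Rightarrow> ('a::field ^ 'n) set set set" where
  "pg_subspaces d = {{P \<in> pg_points. P \<subseteq> U} | U. vec.subspace U \<and> vec.dim U = d + 1}"

abbreviation pg_lines :: "('a::field ^ 'n) set set set" where
  "pg_lines \<equiv> pg_subspaces 1"

abbreviation pg_planes :: "('a::field ^ 'n) set set set" where
  "pg_planes \<equiv> pg_subspaces 2"

definition pg_collineation :: "(('a::field ^ 'n) set \<Rightarrow> ('a ^ 'n) set) \<Rightarrow> bool" where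
  "pg_collineation f \<longleftrightarrow> bij_betw f pg_points pg_points \<and> (\<lambda>L. f ` L) ` pg_lines = pg_lines"

definition polar_form :: "('a::field ^ 'n \<Rightarrow> 'a) \<Rightarrow> 'a ^ 'n \<Rightarrow> 'a ^ 'n \<Rightarrow> 'a" where
  "polar_form Q u v = Q (u + v) - Q u - Q v"

text \<open>
  The polar form is symmetric by definition, so linearity in the first argument
  makes it bilinear.
\<close>

definition quadratic_form :: "('a::field ^ 'n \<Rightarrow> 'a) \<Rightarrow> bool" where
  "quadratic_form Q \<longleftrightarrow>
     (\<forall>c v. Q (c *s v) = c\<^sup>2 * Q v) \<and>
     (\<forall>v. Vector_Spaces.linear (*s) (*) (\<lambda>u. polar_form Q u v))"

definition nondegenerate_form :: "('a::field ^ 'n \<Rightarrow> 'a) \<Rightarrow> bool" where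
  "nondegenerate_form Q \<longleftrightarrow> (\<forall>u. Q u = 0 \<and> (\<forall>v. polar_form Q u v = 0) \<longrightarrow> u = 0)"

definition totally_singular :: "('a::field ^ 'n \<Rightarrow> 'a) \<Rightarrow> ('a ^ 'n) set \<Rightarrow> bool" where
  "totally_singular Q U \<longleftrightarrow> vec.subspace U \<and> (\<forall>u\<in>U. Q u = 0)"

definition witt_index :: "('a::field ^ 'n \<Rightarrow> 'a) \<Rightarrow> nat" where
  "witt_index Q = Max {vec.dim U | U. totally_singular Q U}"

definition quadric :: "('a::field ^ 'n \<Rightarrow> 'a) \<Rightarrow> ('a ^ 'n) set set" where
  "quadric Q = {P \<in> pg_points. \<forall>v\<in>P. Q v = 0}"

definition hyperbolic_form5 :: "('a::field ^ 6 \<Rightarrow> 'a) \<Rightarrow> bool" where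
  "hyperbolic_form5 Q \<longleftrightarrow> quadratic_form Q \<and> nondegenerate_form Q \<and> witt_index Q = 3"

definition generators5 :: "('a::field ^ 6 \<Rightarrow> 'a) \<Rightarrow> ('a ^ 6) set set set" where
  "generators5 Q = {\<pi> \<in> pg_planes. \<pi> \<subseteq> quadric Q}"

definition quadric_perp :: "('a::field ^ 'n \<Rightarrow> 'a) \<Rightarrow> ('a ^ 'n) set \<Rightarrow> ('a ^ 'n) set set" where
  "quadric_perp Q P =
     insert P {R. \<exists>L\<in>pg_lines. L \<subseteq> quadric Q \<and> P \<in> L \<and> R \<in> L}"

definition tight_set5 ::
    "('a::{field,finite} ^ 6 \<Rightarrow> 'a) \<Rightarrow> nat \<Rightarrow> ('a ^ 6) set set \<Rightarrow> bool" where
  "tight_set5 Q x T \<longleftrightarrow> T \<subseteq> quadric Q \<and>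
     (\<forall>P\<in>quadric Q.
        card (quadric_perp Q P \<inter> T) = x * (CARD('a) + 1) + CARD('a)\<^sup>2 * of_bool (P \<in> T))"

definition quadric_collineation ::
    "('a::field ^ 'n \<Rightarrow> 'a) \<Rightarrow> (('a ^ 'n) set \<Rightarrow> ('a ^ 'n) set) \<Rightarrow> bool" where
  "quadric_collineation Q f \<longleftrightarrow> pg_collineation f \<and> f ` quadric Q = quadric Q"

end

theory Submission
  imports Defs "HOL-Algebra.Algebraic_Closure_Type"
begin

text \<open>
  Let $E$ be the cubic extension of $F = \mathrm{GF}(q)$ with trace $T$, and let $\eta$ denote
  quadratic characters.  In suitable coordinates the form is $Q(x,y) = T(xy)$ on $E \times E$; the
  generators are $y=0$ and $x=0$, and every other point of the quadric has $xy \neq 0$, $T(xy)=0$.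
  The two tight sets are the level sets of a sign $\eta(x)e(xy)$, where $e$ is defined on
  $\{z \neq 0 : T(z)=0\}$ by $e(r^2) = e(nr^2) = \varepsilon(r)$ for a fixed nonsquare $n$ of $F$.
  Here $r$ lies on the cone over the conic $T(r^2)=0$, and $\varepsilon$ satisfies
  $\varepsilon(cr)=\eta(c)\varepsilon(r)$ for $c \in F$ and
  $\eta(T(rs)) = \eta(2)\varepsilon(r)\varepsilon(s)$ whenever $T(rs)\neq 0$; it exists because the
  trace form has square discriminant.

  Being tight amounts to this sign being an eigenvector of the collinearity matrix for the eigenvalue
  $q^2$.  The sums over $x$ that occur are of Salie type: since $\eta(x)$ is a function of
  $x + 1/x$, they reduce to $\sum_{T(u)=c}\eta(u) = q\eta(c)$, and what remains is
  $\sum_r \varepsilon(r)\eta(T(rv)) = (q^2-q)\eta(2)\varepsilon(v)$.  Multiplication by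
  $(n, 1/n)$ is an isometry that reverses the sign.
\<close>

hide_const (open) Divisibility.prime

section \<open>The cubic extension of a finite field\<close>

text \<open>The congruence enters as q = 1 mod 4, so that -1 is a square in F and in E. This makes
  epsilon even, as the definition of e(r^2) requires because r is known only up to sign, and it
  makes the two halves eta(s + 2) and eta(s - 2) of the Salie sum contribute equally. The degree 3
  is odd, which keeps a nonsquare n of F a nonsquare in E: the elements r^2 and n r^2 exhaust E, and
  as T(n r^2) = n T(r^2), the trace-zero elements of both classes are parametrised by the same cone.
  Passing to another representative (c x, c y) multiplies both eta(x) and e(xy) by eta(c), so the
  sign depends only on the point. The complement of the two generators is (q^2 - 1)-tight by a
  direct count, and each half of it has indicator (1 + s sign)/2 with s = 1 or -1; hence the
  parameter (q^2 - 1)/2. Counts run over vectors, so an extra factor q - 1 appears throughout, for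
  instance q^3 - q^2 for the eigenvalue q^2.\<close>

lemma finite_field_power_card:
  fixes x :: "'a::{field,finite}"
  shows "x ^ CARD('a) = x"
proof (cases "x = 0")
  case False
  have c: "CARD('a) = Suc (card (UNIV - {0::'a}))"
    by (simp add: card_Diff_singleton)
  have "(\<Prod>y\<in>UNIV - {0}. x * y) = \<Prod>(UNIV - {0})"
    by (rule prod.reindex_bij_witness[of _ "\<lambda>y. y / x" "\<lambda>y. x * y"]) (use False in auto)
  then have "x ^ card (UNIV - {0::'a}) * \<Prod>(UNIV - {0::'a}) = \<Prod>(UNIV - {0})"
    by (simp add: prod.distrib)
  moreover have "\<Prod>(UNIV - {0::'a}) \<noteq> 0"
    by simp
  ultimately have "x ^ card (UNIV - {0::'a}) = 1"
    by (metis mult_cancel_right1)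
  then show ?thesis
    unfolding c by (simp only: power_Suc mult_1_right)
qed simp

lemma card_field_ge_2: "CARD('a::{field,finite}) \<ge> 2"
proof -
  have "card {0, 1::'a} \<le> CARD('a)"
    by (rule card_mono) auto
  then show ?thesis by simp
qed

text \<open>Translation by 1 permutes the field, so it leaves the sum of all elements unchanged
  although it adds q ones.\<close>

lemma of_nat_card_field: "of_nat (CARD('a)) = (0 :: 'a::{field,finite})"
proof -
  have "(\<Sum>x\<in>UNIV. x + 1 :: 'a) = \<Sum>UNIV"
    by (rule sum.reindex_bij_witness[of _ "\<lambda>x. x - 1" "\<lambda>x. x + 1"]) auto
  then show ?thesis by (simp add: sum.distrib)
qed

text \<open>
  For fixed \<open>y\<close> the polynomial $(X+y)^q - X^q - y^q$ has degree less than $q$, so it vanishes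
  once it does so on the $q$ elements of the ground field.  This is used first for \<open>y\<close> in the ground
  field and then for arbitrary \<open>y\<close>.
\<close>

lemma alg_closure_frobenius_add:
  fixes x y :: "'a::{field,finite} alg_closure"
  shows "(x + y) ^ CARD('a) = x ^ CARD('a) + y ^ CARD('a)"
proof -
  define q where "q = CARD('a)"
  have q: "q \<ge> 2" unfolding q_def by (rule card_field_ge_2)
  have Fq: "to_ac c ^ q = to_ac c" for c :: 'a
    unfolding q_def by (metis finite_field_power_card to_ac_power)
  have *: "(x + y) ^ q = x ^ q + y ^ q"
    if "\<And>c::'a. (to_ac c + y) ^ q = to_ac c + y ^ q" for x y :: "'a alg_closure"
  proof -
    define P where "P = [:y, 1:] ^ q - monom 1 q - [:y ^ q:]"
    have "degree P \<le> q"
      unfolding P_def using q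
      by (intro degree_diff_le degree_monom_le) (auto simp: degree_power_eq)
    moreover have "Polynomial.coeff P q = 0"
    proof -
      have "Polynomial.coeff ([:y, 1:] ^ q) q = 1"
        using lead_coeff_power[of "[:y, 1:]" q] by (simp add: degree_power_eq)
      then show ?thesis
        using q by (simp add: P_def coeff_pCons split: nat.splits)
    qed
    ultimately have deg: "P = 0 \<or> degree P < q"
      using q by (metis eq_zero_or_degree_less)
    have "P = 0"
    proof (rule ccontr)
      assume "P \<noteq> 0"
      have "range (to_ac :: 'a \<Rightarrow> _) \<subseteq> {z. poly P z = 0}"
        using that Fq by (auto simp: P_def poly_monom algebra_simps)
      then have "card (range (to_ac :: 'a \<Rightarrow> _)) \<le> card {z. poly P z = 0}"
        using \<open>P \<noteq> 0\<close> by (intro card_mono poly_roots_finite)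
      also have "\<dots> \<le> degree P"
        using \<open>P \<noteq> 0\<close> by (rule card_poly_roots_bound)
      finally show False
        using deg \<open>P \<noteq> 0\<close> by (simp add: card_image inj_to_ac q_def)
    qed
    then have "poly P x = 0" by simp
    then show ?thesis by (simp add: P_def poly_monom algebra_simps)
  qed
  have "(to_ac c + to_ac d) ^ q = to_ac c + to_ac d ^ q" for c d :: 'a
    by (metis Fq to_ac_add)
  from *[OF this] have "(to_ac c + y) ^ q = to_ac c + y ^ q" for c :: 'a
    by (metis Fq add.commute)
  from *[OF this] show ?thesis
    unfolding q_def .
qed

lemma alg_closure_frobenius_power_add:
  fixes x y :: "'a::{field,finite} alg_closure"
  shows "(x + y) ^ (CARD('a) ^ n) = x ^ (CARD('a) ^ n) + y ^ (CARD('a) ^ n)"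
  by (induction n) (simp_all add: power_mult alg_closure_frobenius_add mult.commute[of "CARD('a)"])

lemma alg_closure_frobenius_power_minus:
  fixes x :: "'a::{field,finite} alg_closure"
  shows "(- x) ^ (CARD('a) ^ n) = - (x ^ (CARD('a) ^ n))"
  using alg_closure_frobenius_power_add[of x "- x" n]
  by (simp add: power_0_left eq_neg_iff_add_eq_0 add.commute)

text \<open>The derivative of X^N - X is -1 in this characteristic, so its N roots in the
  algebraically closed field are distinct. For n = 3 these roots form the field with q^3
  elements.\<close>

lemma card_alg_closure_fixed:
  "card {x :: 'a::{field,finite} alg_closure. x ^ (CARD('a) ^ n) = x} = CARD('a) ^ n" if "n > 0"
proof -
  define N where "N = CARD('a) ^ n"
  have N2: "N \<ge> 2"
    unfolding N_def using card_field_ge_2[where 'a='a] that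
    by (metis le_trans one_le_numeral self_le_power)
  have N0: "of_nat N = (0 :: 'a alg_closure)"
  proof -
    have "of_nat (CARD('a)) = (0 :: 'a alg_closure)"
      by (metis of_nat_card_field to_ac_0 to_ac_of_nat)
    then show ?thesis using that by (simp add: N_def)
  qed
  define P :: "'a alg_closure poly" where "P = monom 1 N - [:0, 1:]"
  have deg: "degree P = N"
    unfolding P_def diff_conv_add_uminus using N2
    by (subst degree_add_eq_left) (simp_all add: degree_monom_eq)
  have "P \<noteq> 0" using deg N2 by auto
  have lead: "lead_coeff P = 1"
    unfolding deg using N2 by (simp add: P_def coeff_pCons split: nat.splits)
  have dP: "pderiv P = [:- 1:]"
    by (simp add: P_def pderiv_diff pderiv_monom N0 pderiv_pCons)
  obtain A where A: "size A = degree P" "P = smult (lead_coeff P) (\<Prod>x\<in>#A. [:-x, 1:])"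
    using alg_closed_imp_factorization[OF \<open>P \<noteq> 0\<close>] by blast
  have P: "P = (\<Prod>x\<in>#A. [:-x, 1:])"
    using A(2) lead by simp
  have count1: "count A a = 1" if "a \<in># A" for a
  proof (rule ccontr)
    assume "count A a \<noteq> 1"
    moreover have "count A a > 0" using that by simp
    ultimately have "count A a \<ge> 2" by linarith
    from that obtain B where B: "A = add_mset a B"
      by (metis insert_DiffM)
    with \<open>count A a \<ge> 2\<close> have "count B a > 0" by simp
    then have "a \<in># B" by simp
    then obtain C where C: "B = add_mset a C"
      by (metis insert_DiffM)
    \<comment> \<open>A repeated factor X - a would make a a root of the derivative, the constant
      -1.\<close>
    have "P = [:-a, 1:] * ([:-a, 1:] * (\<Prod>x\<in>#C. [:-x, 1:]))"
      by (simp only: P B C image_mset_add_mset prod_mset.add_mset)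
    then have "poly (pderiv P) a = 0"
      by (simp only: pderiv_mult poly_add poly_mult) simp
    then show False using dP by simp
  qed
  have "{x :: 'a alg_closure. x ^ N = x} = {x. poly P x = 0}"
    by (simp add: P_def poly_monom)
  also have "\<dots> = set_mset A"
    unfolding P by (auto simp: poly_prod_mset prod_mset_zero_iff)
  also have "card \<dots> = size A"
    using count1 by (simp add: size_multiset_overloaded_eq)
  finally show ?thesis
    using A(1) deg by (simp add: N_def)
qed

text \<open>A type of its own rather than a subset of the closure, so that results about finite
  fields apply verbatim to F and to E.\<close>

typedef (overloaded) 'a::"{field,finite}" cubic_ext =
  "{x :: 'a alg_closure. x ^ (CARD('a) ^ 3) = x}"
  by (rule exI[of _ 0]) simp

setup_lifting type_definition_cubic_ext

instantiation cubic_ext :: ("{field,finite}") field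
begin

lift_definition zero_cubic_ext :: "'a cubic_ext" is 0 by simp
lift_definition one_cubic_ext :: "'a cubic_ext" is 1 by simp
lift_definition plus_cubic_ext :: "'a cubic_ext \<Rightarrow> 'a cubic_ext \<Rightarrow> 'a cubic_ext" is "(+)"
  by (simp add: alg_closure_frobenius_power_add)
lift_definition uminus_cubic_ext :: "'a cubic_ext \<Rightarrow> 'a cubic_ext" is uminus
  by (simp add: alg_closure_frobenius_power_minus)
lift_definition minus_cubic_ext :: "'a cubic_ext \<Rightarrow> 'a cubic_ext \<Rightarrow> 'a cubic_ext" is "(-)"
  using alg_closure_frobenius_power_add[of _ "- _"]
  by (metis alg_closure_frobenius_power_minus diff_conv_add_uminus)
lift_definition times_cubic_ext :: "'a cubic_ext \<Rightarrow> 'a cubic_ext \<Rightarrow> 'a cubic_ext" is "(*)"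
  by (simp add: power_mult_distrib)
lift_definition inverse_cubic_ext :: "'a cubic_ext \<Rightarrow> 'a cubic_ext" is inverse
  by (simp add: power_inverse)
lift_definition divide_cubic_ext :: "'a cubic_ext \<Rightarrow> 'a cubic_ext \<Rightarrow> 'a cubic_ext" is "(/)"
  by (simp add: power_divide)

instance
  by standard (transfer; simp add: algebra_simps divide_inverse; fail)+

end

lemma card_cubic_ext: "CARD('a::{field,finite} cubic_ext) = CARD('a) ^ 3"
  using card_alg_closure_fixed[of 3, where 'a='a]
  by (simp add: type_definition.card[OF type_definition_cubic_ext])

text \<open>The count comes first: the cardinality of an infinite type is 0 by convention, so a
  positive value proves finiteness.\<close>

instance cubic_ext :: ("{field,finite}") finite
proof
  have "CARD('a cubic_ext) > 0"
    by (simp add: card_cubic_ext)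
  then show "finite (UNIV :: 'a cubic_ext set)"
    by (rule card_ge_0_finite)
qed

lift_definition emb :: "'a::{field,finite} \<Rightarrow> 'a cubic_ext" is to_ac
  by (metis finite_field_power_card power3_eq_cube power_mult to_ac_power)

lemma emb_simps [simp]:
  "emb 0 = 0" "emb 1 = 1" "emb (a + b) = emb a + emb b" "emb (- a) = - emb a"
  "emb (a - b) = emb a - emb b" "emb (a * b) = emb a * emb b" "emb (inverse a) = inverse (emb a)"
  "emb (a / b) = emb a / emb b"
  by (transfer; simp)+

lemma emb_eq_iff [simp]: "emb a = emb b \<longleftrightarrow> a = b"
  by transfer simp

lemma emb_power [simp]: "emb (a ^ n) = emb a ^ n"
  by (induction n) auto

lemma emb_numeral [simp]: "emb (numeral n) = numeral n"
proof -
  have "emb (of_nat m) = of_nat m" for m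
    by (induction m) auto
  from this[of "numeral n"] show ?thesis by simp
qed

lemma emb_eq_0_iff [simp]: "emb a = 0 \<longleftrightarrow> a = 0"
  using emb_eq_iff[of a 0] by simp

lemma cubic_ext_frobenius_add:
  fixes x y :: "'a::{field,finite} cubic_ext"
  shows "(x + y) ^ CARD('a) = x ^ CARD('a) + y ^ CARD('a)"
proof -
  have R: "Rep_cubic_ext (x ^ n) = Rep_cubic_ext x ^ n" for x :: "'a cubic_ext" and n
    by (induction n) (simp_all add: one_cubic_ext.rep_eq times_cubic_ext.rep_eq)
  show ?thesis
    by (simp add: Rep_cubic_ext_inject[symmetric] R plus_cubic_ext.rep_eq alg_closure_frobenius_add)
qed

text \<open>X^q - X has at most q roots, and the image of F supplies q of them. This is the descent
  criterion: an element of E fixed by the Frobenius comes from F.\<close>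

lemma range_emb: "range (emb :: 'a::{field,finite} \<Rightarrow> _) = {x. x ^ CARD('a) = x}"
proof (rule card_subset_eq)
  let ?P = "monom 1 (CARD('a)) - [:0, 1:] :: 'a cubic_ext poly"
  have deg: "degree ?P = CARD('a)"
    unfolding diff_conv_add_uminus using card_field_ge_2[where 'a='a]
    by (subst degree_add_eq_left) (simp_all add: degree_monom_eq)
  have nz: "?P \<noteq> 0"
    using deg by (metis degree_0 zero_less_card_finite less_irrefl)
  show sub: "range (emb :: 'a \<Rightarrow> _) \<subseteq> {x. x ^ CARD('a) = x}"
    by (auto simp flip: emb_power simp: finite_field_power_card)
  have "card {x :: 'a cubic_ext. x ^ CARD('a) = x} = card {x. poly ?P x = 0}"
    by (simp add: poly_monom)
  also have "\<dots> \<le> CARD('a)"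
    using card_poly_roots_bound[OF nz] deg by simp
  finally have "card {x :: 'a cubic_ext. x ^ CARD('a) = x} \<le> CARD('a)" .
  moreover have "card (range (emb :: 'a \<Rightarrow> _)) = CARD('a)"
    by (simp add: card_image inj_on_def)
  ultimately show "card (range (emb :: 'a \<Rightarrow> _)) = card {x :: 'a cubic_ext. x ^ CARD('a) = x}"
    using card_mono[OF _ sub] by simp
qed simp

section \<open>The trace\<close>

lemma cubic_ext_frobenius_3:
  fixes x :: "'a::{field,finite} cubic_ext"
  shows "((x ^ CARD('a)) ^ CARD('a)) ^ CARD('a) = x"
  using finite_field_power_card[of x]
  by (simp add: card_cubic_ext power3_eq_cube flip: power_mult)

text \<open>The sum of the three conjugates is Frobenius-invariant; pulling it back along
  \<open>emb\<close> gives the trace values in F itself.\<close>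

definition tr :: "'a::{field,finite} cubic_ext \<Rightarrow> 'a" where
  "tr x = inv_into UNIV emb (x + x ^ CARD('a) + (x ^ CARD('a)) ^ CARD('a))"

lemma emb_tr: "emb (tr x) = x + x ^ CARD('a) + (x ^ CARD('a)) ^ CARD('a)"
  for x :: "'a::{field,finite} cubic_ext"
proof -
  have "(x + x ^ CARD('a) + (x ^ CARD('a)) ^ CARD('a)) ^ CARD('a) =
      x + x ^ CARD('a) + (x ^ CARD('a)) ^ CARD('a)"
    by (simp add: cubic_ext_frobenius_add cubic_ext_frobenius_3)
  then have "x + x ^ CARD('a) + (x ^ CARD('a)) ^ CARD('a) \<in> range (emb :: 'a \<Rightarrow> _)"
    unfolding range_emb by simp
  then show ?thesis
    unfolding tr_def by (rule f_inv_into_f)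
qed

text \<open>The norm from E to F, used to carry square roots from E down to F.\<close>

lemma norm_in_range_emb: "x * x ^ CARD('a) * (x ^ CARD('a)) ^ CARD('a) \<in> range emb"
  for x :: "'a::{field,finite} cubic_ext"
  unfolding range_emb by (simp add: power_mult_distrib cubic_ext_frobenius_3)

lemma emb_power_card: "emb c ^ CARD('a) = emb c" for c :: "'a::{field,finite}"
  by (simp add: finite_field_power_card flip: emb_power)

lemma tr_add: "tr (x + y) = tr x + tr y"
proof -
  have "emb (tr (x + y)) = emb (tr x + tr y)"
    by (simp add: emb_tr cubic_ext_frobenius_add)
  then show ?thesis by (simp only: emb_eq_iff)
qed

lemma tr_scale: "tr (emb c * x) = c * tr x"
proof -
  have "emb (tr (emb c * x)) = emb (c * tr x)"
    by (simp add: emb_tr power_mult_distrib emb_power_card distrib_left)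
  then show ?thesis by (simp only: emb_eq_iff)
qed

lemma tr_scale_right: "tr (x * (emb c * y)) = c * tr (x * y)"
  by (simp add: tr_scale mult.left_commute[of x])

lemma tr_0 [simp]: "tr 0 = 0"
  using tr_scale[of 0 0] by simp

lemma tr_minus: "tr (- x) = - tr x"
  using tr_scale[of "-1" x] by simp

lemma tr_diff: "tr (x - y) = tr x - tr y"
  using tr_add[of x "- y"] by (simp add: tr_minus)

lemma tr_sum: "tr (sum f A) = (\<Sum>i\<in>A. tr (f i))"
  by (induction A rule: infinite_finite_induct) (auto simp: tr_add)

section \<open>Nondegeneracy of the trace form and its hyperplanes\<close>

lemma ex_tr_nonzero: "\<exists>u :: 'a::{field,finite} cubic_ext. tr u \<noteq> 0"
proof (rule ccontr)
  let ?q = "CARD('a)"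
  \<comment> \<open>The trace is a polynomial function of degree q^2, which cannot vanish at all q^3
    elements.\<close>
  let ?P = "[:0, 1:] + monom 1 ?q + monom 1 (?q * ?q) :: 'a cubic_ext poly"
  assume "\<nexists>u :: 'a cubic_ext. tr u \<noteq> 0"
  then have "x + x ^ ?q + x ^ (?q * ?q) = 0" for x :: "'a cubic_ext"
    using emb_tr[of x] by (simp add: power_mult)
  then have all: "{x. poly ?P x = 0} = UNIV"
    by (auto simp: poly_monom)
  have q2: "?q \<ge> 2" by (rule card_field_ge_2)
  then have lt: "?q < ?q * ?q" "1 < ?q * ?q"
    using less_1_mult[of ?q ?q] by auto
  have deg: "degree ?P \<le> ?q * ?q"
    using lt by (intro degree_add_le) (auto simp: degree_monom_eq)
  have "Polynomial.coeff ?P (?q * ?q) = 1"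
    using lt by (auto simp: coeff_pCons split: nat.splits)
  then have "?P \<noteq> 0" by (metis coeff_0 zero_neq_one)
  then have "card {x. poly ?P x = 0} \<le> ?q * ?q"
    using card_poly_roots_bound[of ?P] deg by linarith
  then have "?q ^ 3 \<le> ?q ^ 2"
    unfolding all by (simp add: card_cubic_ext power2_eq_square)
  then show False using q2 by (simp add: power_increasing_iff)
qed

lemma ex_tr_mult_nonzero: "\<exists>u. tr (k * u) \<noteq> 0" if "k \<noteq> 0"
  for k :: "'a::{field,finite} cubic_ext"
proof -
  obtain u :: "'a cubic_ext" where "tr u \<noteq> 0" using ex_tr_nonzero by blast
  with that show ?thesis by (intro exI[of _ "u / k"]) simp
qed

text \<open>A is an F-subspace on which x -> tr(k x) is nonzero; a multiple of u translates any
  fibre onto any other, so all q fibres have equal size. Iterated over successive kernels, this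
  takes the place of dimension counts in E.\<close>

lemma card_tr_fibre:
  fixes A :: "'a::{field,finite} cubic_ext set"
  assumes add: "\<And>x y. x \<in> A \<Longrightarrow> y \<in> A \<Longrightarrow> x + y \<in> A"
    and scale: "\<And>c x. x \<in> A \<Longrightarrow> emb c * x \<in> A"
    and u: "u \<in> A" "tr (k * u) \<noteq> 0"
  shows "CARD('a) * card {x \<in> A. tr (k * x) = c} = card A"
proof -
  have fib: "card {x \<in> A. tr (k * x) = d} = card {x \<in> A. tr (k * x) = c}" for d
  proof (rule bij_betw_same_card)
    \<comment> \<open>The multiple of u at which the functional takes the value c - d.\<close>
    define w where "w = emb ((c - d) / tr (k * u)) * u"
    have w: "w \<in> A" "- w \<in> A" and trw: "tr (k * w) = c - d"
      using scale[OF u(1), of "(c - d) / tr (k * u)"] scale[OF u(1), of "- ((c - d) / tr (k * u))"]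
        tr_scale[of "(c - d) / tr (k * u)" "k * u"] u(2)
      by (simp_all add: w_def mult.left_commute)
    have A: "x + w \<in> A" "x - w \<in> A" if "x \<in> A" for x
      using add[OF that w(1)] add[OF that w(2)] by simp_all
    have T: "tr (k * (x + w)) = tr (k * x) + (c - d)" "tr (k * (x - w)) = tr (k * x) - (c - d)" for x
      by (simp_all only: distrib_left right_diff_distrib tr_add tr_diff trw)
    show "bij_betw (\<lambda>x. x + w) {x \<in> A. tr (k * x) = d} {x \<in> A. tr (k * x) = c}"
      by (rule bij_betw_byWitness[where f' = "\<lambda>x. x - w"]) (auto simp: A T)
  qed
  have "card A = (\<Sum>d\<in>UNIV. card {x \<in> A. tr (k * x) = d})"
    by (subst card_eq_sum, subst sum.group[of A UNIV "\<lambda>x. tr (k * x)", symmetric]) auto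
  also have "\<dots> = (\<Sum>d\<in>(UNIV::'a set). card {x \<in> A. tr (k * x) = c})"
    by (intro sum.cong refl fib)
  finally show ?thesis by simp
qed

lemma card_tr_eq:
  fixes k :: "'a::{field,finite} cubic_ext"
  assumes "k \<noteq> 0"
  shows "card {x. tr (k * x) = c} = CARD('a)\<^sup>2"
proof -
  obtain u where "tr (k * u) \<noteq> 0" using ex_tr_mult_nonzero[OF assms] by blast
  from card_tr_fibre[of UNIV u k c, OF _ _ _ this]
  show ?thesis by (simp add: card_cubic_ext power2_eq_square power3_eq_cube)
qed

text \<open>The functional of x' is c times that of x at u and on the kernel of the latter, hence
  everywhere; nondegeneracy transfers the proportionality to x and x'.\<close>

lemma proportional_if_tr_kernel_le:
  assumes "x \<noteq> 0" and ker: "\<And>y. tr (x * y) = 0 \<Longrightarrow> tr (x' * y) = 0"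
  shows "\<exists>c. x' = emb c * x"
proof -
  obtain u where u: "tr (x * u) \<noteq> 0" using ex_tr_mult_nonzero[OF assms(1)] by blast
  define c where "c = tr (x' * u) / tr (x * u)"
  have "tr ((x' - emb c * x) * y) = 0" for y
  proof -
    define d where "d = tr (x * y) / tr (x * u)"
    have "tr (x * (y - emb d * u)) = 0"
      using u tr_scale[of d "x * u"] by (simp add: algebra_simps tr_diff d_def)
    then have "tr (x' * (y - emb d * u)) = 0" by (rule ker)
    then have "tr (x' * y) = d * tr (x' * u)"
      using tr_scale[of d "x' * u"] by (simp add: algebra_simps tr_diff)
    then show ?thesis
      using tr_scale[of c "x * y"] by (simp add: algebra_simps tr_diff c_def d_def)
  qed
  then have "x' - emb c * x = 0" using ex_tr_mult_nonzero by blast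
  then show ?thesis by auto
qed

lemma card_tr_eq_two:
  fixes x x' :: "'a::{field,finite} cubic_ext"
  assumes "x \<noteq> 0" "x' \<notin> range (\<lambda>c. emb c * x)"
  shows "card {y. tr (x * y) = 0 \<and> tr (x' * y) = c} = CARD('a)"
proof -
  let ?A = "{y. tr (x * y) = 0}"
  obtain u where u: "u \<in> ?A" "tr (x' * u) \<noteq> 0"
    using proportional_if_tr_kernel_le[OF assms(1), of x'] assms(2) by blast
  have "CARD('a) * card {y \<in> ?A. tr (x' * y) = c} = card ?A"
    by (rule card_tr_fibre[OF _ _ u]) (auto simp: tr_add tr_scale tr_scale_right distrib_left)
  then show ?thesis
    using card_tr_eq[OF assms(1), of 0] by (simp add: power2_eq_square)
qed

text \<open>Three functionals with trivial common kernel embed E into F^3, and equal cardinalities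
  make the embedding onto; the preimages of the unit vectors form the basis dual to f.\<close>

lemma ex_tr_dual_bases:
  "\<exists>e f :: 3 \<Rightarrow> 'a::{field,finite} cubic_ext.
    (\<forall>i j. tr (e i * f j) = (if j = i then 1 else 0)) \<and> (\<forall>x. x = (\<Sum>i\<in>UNIV. emb (tr (x * f i)) * e i))"
proof -
  \<comment> \<open>Any g outside F gives a second functional independent of the trace
    itself.\<close>
  have "card (range (emb :: 'a \<Rightarrow> _)) \<noteq> CARD('a cubic_ext)"
    using card_field_ge_2[where 'a='a] by (simp add: card_image inj_on_def card_cubic_ext power_eq_if)
  then obtain g where g: "g \<notin> range (emb :: 'a \<Rightarrow> _)"
    by (metis UNIV_eq_I)
  let ?A = "{y. tr (1 * y) = 0 \<and> tr (g * y) = 0}"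
  have cA: "card ?A = CARD('a)"
    by (rule card_tr_eq_two) (use g in auto)
  have "?A \<noteq> {0}"
    using cA card_field_ge_2[where 'a='a] by auto
  then obtain k where k: "k \<in> ?A" "k \<noteq> 0"
    by (metis (mono_tags, lifting) mem_Collect_eq mult_zero_right singletonI subsetI subset_singletonD tr_0 empty_iff)
  \<comment> \<open>The functional of h is nonzero on the q elements killed by the first two
    functionals, so only one element is killed by all three.\<close>
  obtain h where h: "tr (h * k) \<noteq> 0"
    using ex_tr_mult_nonzero[OF k(2)] by (metis mult.commute)
  have "CARD('a) * card {y \<in> ?A. tr (h * y) = 0} = card ?A"
    by (rule card_tr_fibre[OF _ _ k(1) h]) (auto simp: tr_add tr_scale tr_scale_right distrib_left)
  then have "card {y \<in> ?A. tr (h * y) = 0} = 1"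
    unfolding cA by simp
  then obtain z where z: "{y \<in> ?A. tr (h * y) = 0} = {z}"
    by (rule card_1_singletonE)
  have ker: "y = 0" if "tr y = 0" "tr (g * y) = 0" "tr (h * y) = 0" for y
  proof -
    have "y \<in> {y \<in> ?A. tr (h * y) = 0}" "0 \<in> {y \<in> ?A. tr (h * y) = 0}"
      using that by auto
    then show ?thesis unfolding z by simp
  qed
  define f :: "3 \<Rightarrow> 'a cubic_ext" where "f = (\<lambda>i. if i = 1 then 1 else if i = 2 then g else h)"
  define \<Phi> :: "'a cubic_ext \<Rightarrow> 'a ^ 3" where "\<Phi> x = (\<chi> i. tr (x * f i))" for x
  have f3: "f 1 = 1" "f 2 = g" "f 3 = h"
    by (simp_all add: f_def)
  have ker': "x = 0" if "\<And>i. tr (x * f i) = 0" for x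
    using ker[of x] that[of 1] that[of 2] that[of 3] by (simp add: f3 mult.commute)
  have "inj \<Phi>"
  proof (rule injI)
    fix x y assume "\<Phi> x = \<Phi> y"
    then have "tr ((x - y) * f i) = 0" for i
      by (simp add: \<Phi>_def vec_eq_iff left_diff_distrib tr_diff)
    then show "x = y" using ker'[of "x - y"] by simp
  qed
  moreover have "CARD('a cubic_ext) = CARD('a ^ 3)"
    by (simp add: card_cubic_ext)
  ultimately have "surj \<Phi>"
    by (metis card_subset_eq card_image finite subset_UNIV)
  then have "\<forall>i. \<exists>y. \<Phi> y = axis i 1"
    by (metis surjD)
  then obtain e where e: "\<And>i. \<Phi> (e i) = axis i 1"
    by metis
  have ef: "tr (e i * f j) = (if j = i then 1 else 0)" for i j
    using arg_cong[OF e[of i], of "\<lambda>v. v $ j"] by (simp add: \<Phi>_def axis_def)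
  have "x = (\<Sum>i\<in>UNIV. emb (tr (x * f i)) * e i)" for x
  proof -
    have "tr ((x - (\<Sum>i\<in>UNIV. emb (tr (x * f i)) * e i)) * f j) = 0" for j
      by (simp add: left_diff_distrib tr_diff sum_distrib_right tr_sum mult.assoc tr_scale ef
          if_distrib[of "\<lambda>t. _ * t"] cong: if_cong)
    from ker'[OF this] show ?thesis by simp
  qed
  with ef show ?thesis by blast
qed

section \<open>The quadratic character\<close>

definition qchar :: "'a::field \<Rightarrow> int" where
  "qchar x = (if x = 0 then 0 else if \<exists>y. x = y\<^sup>2 then 1 else - 1)"

lemma qchar_0 [simp]: "qchar 0 = 0"
  by (simp add: qchar_def)

lemma qchar_eq_0_iff [simp]: "qchar x = 0 \<longleftrightarrow> x = 0"
  by (simp add: qchar_def)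

lemma qchar_square: "y \<noteq> 0 \<Longrightarrow> qchar (y\<^sup>2) = 1"
  by (auto simp: qchar_def)

lemma qchar_1 [simp]: "qchar 1 = 1"
  using qchar_square[of 1] by simp

lemma qchar_cases: "x \<noteq> 0 \<Longrightarrow> qchar x = 1 \<or> qchar x = - 1"
  by (simp add: qchar_def)

lemma card_square_roots:
  fixes x :: "'a::{field,finite}"
  assumes two: "(2::'a) \<noteq> 0"
  shows "int (card {y. y\<^sup>2 = x}) = 1 + qchar x"
proof -
  consider "x = 0" | a where "x = a\<^sup>2" "a \<noteq> 0" | "x \<noteq> 0" "\<nexists>y. x = y\<^sup>2"
    by force
  then show ?thesis
  proof cases
    case 1
    then have "{y. y\<^sup>2 = x} = {0}" by auto
    with 1 show ?thesis by simp
  next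
    case 2
    then have "{y. y\<^sup>2 = x} = {a, - a}"
      by (auto simp: power2_eq_iff)
    moreover have "a \<noteq> - a"
      using two 2 by (metis add.right_inverse mult_2 mult_eq_0_iff)
    ultimately show ?thesis
      using 2 by (simp add: qchar_square)
  next
    case 3
    then have "{y. y\<^sup>2 = x} = {}" by auto
    with 3 show ?thesis by (simp add: qchar_def)
  qed
qed

text \<open>Squaring hits u exactly 1 + eta(u) times.\<close>

lemma sum_squares_eq:
  fixes g :: "'a::{field,finite} \<Rightarrow> int"
  assumes two: "(2::'a) \<noteq> 0"
  shows "(\<Sum>y\<in>UNIV. g (y\<^sup>2)) = (\<Sum>u\<in>UNIV. (1 + qchar u) * g u)"
proof -
  have "(\<Sum>y\<in>UNIV. g (y\<^sup>2)) = (\<Sum>u\<in>UNIV. \<Sum>y\<in>{y\<in>UNIV. y\<^sup>2 = u}. g (y\<^sup>2))"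
    by (subst sum.group) auto
  also have "\<dots> = (\<Sum>u\<in>UNIV. (1 + qchar u) * g u)"
    by (rule sum.cong) (simp_all add: card_square_roots[OF two, symmetric])
  finally show ?thesis .
qed

lemma sum_qchar:
  assumes two: "(2::'a::{field,finite}) \<noteq> 0"
  shows "(\<Sum>u\<in>(UNIV::'a set). qchar u) = 0"
  using sum_squares_eq[OF two, of "\<lambda>_. 1"] by (simp add: sum.distrib)

lemma ex_nonsquare:
  assumes two: "(2::'a::{field,finite}) \<noteq> 0"
  shows "\<exists>n::'a. qchar n = - 1"
proof (rule ccontr)
  assume "\<nexists>n::'a. qchar n = - 1"
  then have nn: "qchar n \<ge> 0" for n :: 'a
    using qchar_cases[of n] by (cases "n = 0") auto
  have "qchar (1::'a) \<le> (\<Sum>u\<in>(UNIV::'a set). qchar u)"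
    by (rule member_le_sum) (use nn in auto)
  then show False using sum_qchar[OF two] by simp
qed

lemma qchar_mult_square:
  fixes a b :: "'a::field"
  shows "a \<noteq> 0 \<Longrightarrow> qchar (a\<^sup>2 * b) = qchar b"
proof -
  assume a: "a \<noteq> 0"
  have "(\<exists>y. a\<^sup>2 * b = y\<^sup>2) \<longleftrightarrow> (\<exists>y. b = y\<^sup>2)"
  proof
    assume "\<exists>y. a\<^sup>2 * b = y\<^sup>2"
    then obtain y where "a\<^sup>2 * b = y\<^sup>2" ..
    then have "b = (y / a)\<^sup>2" using a by (simp add: power_divide field_simps)
    then show "\<exists>y. b = y\<^sup>2" ..
  next
    assume "\<exists>y. b = y\<^sup>2"
    then show "\<exists>y. a\<^sup>2 * b = y\<^sup>2" by (metis power_mult_distrib)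
  qed
  then show ?thesis using a by (simp add: qchar_def)
qed

text \<open>For a nonsquare a, each eta(a u) + eta(u) is at most 0: a nonzero square u gives -1 + 1,
  and any other nonzero u gives at most 1 - 1. These terms sum to 0 over the field, so all of them
  vanish.\<close>

lemma qchar_mult:
  fixes a b :: "'a::{field,finite}"
  assumes two: "(2::'a) \<noteq> 0"
  shows "qchar (a * b) = qchar a * qchar b"
proof (cases "a = 0 \<or> b = 0")
  case False
  consider y where "a = y\<^sup>2" | "qchar a = - 1"
    using qchar_def[of a] False by metis
  then show ?thesis
  proof cases
    case 1
    with False have "y \<noteq> 0" by auto
    then show ?thesis unfolding 1 by (simp add: qchar_mult_square qchar_square)
  next
    case 2
    have nonpos: "qchar (a * u) + qchar u \<le> 0" for u
    proof (cases "\<exists>y. y \<noteq> 0 \<and> u = y\<^sup>2")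
      case True
      then obtain y where "y \<noteq> 0" "u = y\<^sup>2" by blast
      then show ?thesis
        using qchar_mult_square[of y a] 2 by (simp add: qchar_square mult.commute)
    next
      case False
      then have "u = 0 \<or> qchar u = - 1" by (auto simp: qchar_def)
      moreover have "qchar (a * u) \<le> 1" by (simp add: qchar_def)
      ultimately show ?thesis by auto
    qed
    have "(\<Sum>u\<in>UNIV. qchar (a * u)) = (\<Sum>u\<in>UNIV. qchar (u::'a))"
      by (rule sum.reindex_bij_witness[of _ "\<lambda>u. u / a" "\<lambda>u. a * u"]) (use False in auto)
    then have "(\<Sum>u\<in>UNIV. - (qchar (a * u) + qchar u)) = 0"
      using sum_qchar[OF two] by (simp add: sum.distrib sum_negf del: minus_add_distrib)
    then have "- (qchar (a * b) + qchar b) = 0"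
      using sum_nonneg_eq_0_iff[of UNIV "\<lambda>u. - (qchar (a * u) + qchar u)"] nonpos
      by (metis UNIV_I finite neg_0_le_iff_le)
    then show ?thesis using 2 by simp
  qed
qed auto

lemma two_nonzero:
  assumes "CARD('a::{field,finite}) mod 4 = 1"
  shows "(2::'a) \<noteq> 0"
proof
  assume "(2::'a) = 0"
  then have "(of_nat (2 * (2 * (CARD('a) div 4)) + 1) :: 'a) = 1"
    unfolding of_nat_add of_nat_mult by simp
  moreover have "2 * (2 * (CARD('a) div 4)) + 1 = CARD('a)"
    using assms by presburger
  ultimately show False
    using of_nat_card_field[where 'a='a] by (metis one_neq_zero)
qed

text \<open>With q = 4m + 1, some nonzero x is not a root of X^(2m) - 1; then x^(2m), whose square
  is 1, equals -1, and x^m is a square root of -1.\<close>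

lemma qchar_minus_1:
  assumes q1: "CARD('a::{field,finite}) mod 4 = 1"
  shows "qchar (- 1 :: 'a) = 1"
proof -
  define m where "m = CARD('a) div 4"
  have qm: "CARD('a) = 4 * m + 1"
    using q1 div_mult_mod_eq[of "CARD('a)" 4] by (simp add: m_def)
  then have m: "m > 0" using card_field_ge_2[where 'a='a] by simp
  let ?P = "monom 1 (2 * m) - 1 :: 'a poly"
  have "degree ?P \<le> 2 * m"
    by (intro degree_diff_le degree_monom_le) auto
  moreover have "poly ?P 0 = - 1"
    using m by (simp add: poly_monom)
  then have nz: "?P \<noteq> 0" by (metis neg_equal_0_iff_equal one_neq_zero poly_0)
  ultimately have "card {x. poly ?P x = 0} \<le> 2 * m"
    using card_poly_roots_bound[OF nz] by linarith
  then have "card {x. poly ?P x = 0} < card (UNIV - {0::'a})"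
    using m by (simp add: card_Diff_singleton qm)
  then obtain x where x: "x \<noteq> 0" "poly ?P x \<noteq> 0"
    by (metis (mono_tags, lifting) Diff_iff UNIV_I card_mono finite insertI1 mem_Collect_eq not_less subsetI)
  have "x * (x ^ (2 * m))\<^sup>2 = x"
    using finite_field_power_card[of x] by (simp add: qm flip: power_mult)
  then have "(x ^ (2 * m))\<^sup>2 = 1" using x(1) by simp
  then have "x ^ (2 * m) = - 1"
    using x(2) by (auto simp: poly_monom power2_eq_1_iff)
  then have "- 1 = (x ^ m)\<^sup>2" by (simp add: mult.commute flip: power_mult)
  then show ?thesis by (metis qchar_square neg_equal_0_iff_equal one_neq_zero zero_power2)
qed

lemma qchar_minus:
  fixes x :: "'a::{field,finite}"
  assumes q1: "CARD('a) mod 4 = 1"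
  shows "qchar (- x) = qchar x"
  using qchar_mult[OF two_nonzero[OF q1], of "- 1" x] qchar_minus_1[OF q1] by simp

text \<open>The degree 3 is odd: if c = y^2 with y in E, taking norms gives c^3 = d^2 with d in F,
  so c = (d/c)^2.\<close>

lemma qchar_emb:
  fixes c :: "'a::{field,finite}"
  shows "qchar (emb c) = qchar c"
proof -
  have "\<exists>b. c = b\<^sup>2" if c: "c \<noteq> 0" and y: "emb c = y\<^sup>2" for y
  proof -
    obtain d where d: "emb d = y * y ^ CARD('a) * (y ^ CARD('a)) ^ CARD('a)"
      using norm_in_range_emb[of y] by auto
    have "emb (d\<^sup>2) = y\<^sup>2 * (y\<^sup>2) ^ CARD('a) * ((y\<^sup>2) ^ CARD('a)) ^ CARD('a)"
      by (simp add: d power_mult_distrib mult_ac flip: power_mult)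
    also have "\<dots> = emb (c ^ 3)"
      by (simp add: y[symmetric] emb_power_card power3_eq_cube)
    finally have "d\<^sup>2 = c ^ 3" by (simp only: emb_eq_iff)
    then have "c = (d / c)\<^sup>2"
      using c by (simp add: power_divide power2_eq_square power3_eq_cube)
    then show ?thesis ..
  qed
  moreover have "\<exists>y. emb c = y\<^sup>2" if "c = b\<^sup>2" for b
    using that by (metis emb_power)
  ultimately show ?thesis by (auto simp: qchar_def)
qed

section \<open>The conic of isotropic elements\<close>

text \<open>This is det(M)^2 = det(M M^T) for a 3 x 3 matrix M. With rows of conjugates, the entries
  of M M^T are trace values.\<close>

lemma gram_det_eq_det_square:
  fixes a1 a2 a3 b1 b2 b3 c1 c2 c3 :: "'b::comm_ring_1"
  defines "g \<equiv> \<lambda>x1 x2 x3 y1 y2 y3. x1 * y1 + x2 * y2 + x3 * y3"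
  shows "(a1 * b2 * c3 + a2 * b3 * c1 + a3 * b1 * c2 - a1 * b3 * c2 - a2 * b1 * c3 - a3 * b2 * c1)\<^sup>2 =
    g a1 a2 a3 a1 a2 a3 * g b1 b2 b3 b1 b2 b3 * g c1 c2 c3 c1 c2 c3
    + 2 * g a1 a2 a3 b1 b2 b3 * g b1 b2 b3 c1 c2 c3 * g a1 a2 a3 c1 c2 c3
    - g a1 a2 a3 a1 a2 a3 * (g b1 b2 b3 c1 c2 c3)\<^sup>2
    - g b1 b2 b3 b1 b2 b3 * (g a1 a2 a3 c1 c2 c3)\<^sup>2
    - g c1 c2 c3 c1 c2 c3 * (g a1 a2 a3 b1 b2 b3)\<^sup>2"
  unfolding g_def by (simp add: power2_eq_square algebra_simps)

text \<open>
  The Frobenius permutes the columns of the matrix of conjugates cyclically, hence evenly, so its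
  determinant lies in the ground field and the trace form has square discriminant.
\<close>

lemma tr_gram_square:
  fixes x y z :: "'a::{field,finite} cubic_ext"
  shows "\<exists>d. d\<^sup>2 = tr (x\<^sup>2) * tr (y\<^sup>2) * tr (z\<^sup>2) + 2 * tr (x * y) * tr (y * z) * tr (x * z)
    - tr (x\<^sup>2) * (tr (y * z))\<^sup>2 - tr (y\<^sup>2) * (tr (x * z))\<^sup>2 - tr (z\<^sup>2) * (tr (x * y))\<^sup>2"
proof -
  define s where "s x = x ^ CARD('a)" for x :: "'a cubic_ext"
  have s_mult: "s (x * y) = s x * s y" and s_add: "s (x + y) = s x + s y" and s3: "s (s (s x)) = x"
    for x y
    by (simp_all add: s_def power_mult_distrib cubic_ext_frobenius_add cubic_ext_frobenius_3)
  have s_diff: "s (x - y) = s x - s y" for x y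
    using s_add[of "x - y" y] by simp
  define D where "D = x * s y * s (s z) + s x * s (s y) * z + s (s x) * y * s z
    - x * s (s y) * s z - s x * y * s (s z) - s (s x) * s y * z"
  have "s D = D"
    unfolding D_def s_diff s_add s_mult s3 by (simp add: algebra_simps)
  then have "D \<in> range emb"
    unfolding range_emb by (simp add: s_def)
  then obtain d where d: "D = emb d" by auto
  have tr: "emb (tr u) = u + s u + s (s u)" for u
    by (simp add: emb_tr s_def)
  have "emb (d\<^sup>2) = emb (tr (x\<^sup>2) * tr (y\<^sup>2) * tr (z\<^sup>2) + 2 * tr (x * y) * tr (y * z) * tr (x * z)
    - tr (x\<^sup>2) * (tr (y * z))\<^sup>2 - tr (y\<^sup>2) * (tr (x * z))\<^sup>2 - tr (z\<^sup>2) * (tr (x * y))\<^sup>2)"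
    using gram_det_eq_det_square[where ?a1.0 = x and ?a2.0 = "s x" and ?a3.0 = "s (s x)"
        and ?b1.0 = y and ?b2.0 = "s y" and ?b3.0 = "s (s y)"
        and ?c1.0 = z and ?c2.0 = "s z" and ?c3.0 = "s (s z)"]
    unfolding emb_power d[symmetric] D_def
    by (simp add: tr power2_eq_square[of x] power2_eq_square[of y] power2_eq_square[of z] s_mult)
  then show ?thesis by (metis emb_eq_iff)
qed

locale field_card_1_mod_4 =
  fixes F :: "'a::{field,finite} itself"
  assumes q1: "CARD('a) mod 4 = 1"
begin

lemma card_ext_mod_4: "CARD('a cubic_ext) mod 4 = 1"
proof -
  have "CARD('a) ^ 3 mod 4 = 1"
    using q1 by (metis mod_mod_trivial power_mod power_one)
  then show ?thesis by (simp add: card_cubic_ext)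
qed

lemmas two_F = two_nonzero[OF q1]
lemmas two_E = two_nonzero[OF card_ext_mod_4]
lemmas qchar_mult_F = qchar_mult[OF two_F]
lemmas qchar_mult_E = qchar_mult[OF two_E]
lemmas qchar_minus_F = qchar_minus[OF q1]

lemma qchar_F_square [simp]: "(c::'a) \<noteq> 0 \<Longrightarrow> qchar c * qchar c = 1"
  using qchar_cases[of c] by auto

text \<open>r^2 hits z exactly 1 + eta(z) times and n r^2 hits it 1 - eta(z) times, because n
  remains a nonsquare in E.\<close>

lemma sum_two_classes:
  fixes n :: 'a and g :: "'a cubic_ext \<Rightarrow> int"
  assumes n: "qchar n = - 1"
  shows "(\<Sum>r\<in>UNIV. g (r\<^sup>2)) + (\<Sum>r\<in>UNIV. g (emb n * r\<^sup>2)) = 2 * (\<Sum>z\<in>UNIV. g z)"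
proof -
  have n0: "n \<noteq> 0" using n by auto
  have "(\<Sum>r\<in>UNIV. g (emb n * r\<^sup>2)) = (\<Sum>u\<in>UNIV. (1 + qchar u) * g (emb n * u))"
    using sum_squares_eq[OF two_E, of "\<lambda>u. g (emb n * u)"] by simp
  also have "\<dots> = (\<Sum>z\<in>UNIV. (1 - qchar z) * g z)"
    by (rule sum.reindex_bij_witness[of _ "\<lambda>z. z / emb n" "\<lambda>u. emb n * u"])
      (use n0 in \<open>auto simp: qchar_mult_E qchar_emb n\<close>)
  finally show ?thesis
    using sum_squares_eq[OF two_E, of g]
    by (simp add: sum.distrib sum_subtractf left_diff_distrib distrib_right)
qed

text \<open>Since tr(n r^2) = n tr(r^2), both square classes give the same count in
  \<open>sum_two_classes\<close>; the cone therefore has as many elements as the trace-zero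
  hyperplane.\<close>

lemma card_isotropic: "card {r :: 'a cubic_ext. tr (r\<^sup>2) = 0} = CARD('a)\<^sup>2"
proof -
  obtain n :: 'a where n: "qchar n = - 1" using ex_nonsquare[OF two_F] by blast
  then have n0: "n \<noteq> 0" by auto
  have "2 * (\<Sum>r\<in>(UNIV :: 'a cubic_ext set). of_bool (tr (r\<^sup>2) = 0) :: int) =
      2 * (\<Sum>z\<in>(UNIV :: 'a cubic_ext set). of_bool (tr z = 0))"
    using sum_two_classes[OF n, of "\<lambda>z. of_bool (tr z = 0)"] n0 by (simp add: tr_scale)
  then have "int (card {r :: 'a cubic_ext. tr (r\<^sup>2) = 0}) = int (card {z :: 'a cubic_ext. tr z = 0})"
    by simp
  then show ?thesis
    using card_tr_eq[of "1 :: 'a cubic_ext" 0] by simp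
qed

text \<open>Adding t v keeps tr(v y) fixed and shifts tr(y^2) by 2 t tr(v y), which runs through F
  with t. Off the hyperplane perpendicular to v the values tr(y^2) are thus equidistributed, each
  taken (q^3 - q^2)/q times.\<close>

lemma sum_tr_square_nonperp:
  fixes v :: "'a cubic_ext" and g :: "'a \<Rightarrow> int"
  assumes v: "v \<noteq> 0" "tr (v\<^sup>2) = 0"
  shows "(\<Sum>y | tr (v * y) \<noteq> 0. g (tr (y\<^sup>2))) = ((int CARD('a))\<^sup>2 - (int CARD('a))) * (\<Sum>c\<in>UNIV. g c)"
proof -
  let ?B = "{y. tr (v * y) \<noteq> 0}"
  have trans: "tr ((y + emb t * v)\<^sup>2) = tr (y\<^sup>2) + 2 * t * tr (v * y)" for y t
  proof -
    have "(y + emb t * v)\<^sup>2 = y\<^sup>2 + emb (2 * t) * (v * y) + emb (t\<^sup>2) * v\<^sup>2"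
      by (simp add: power2_eq_square algebra_simps)
    then show ?thesis using v by (simp only: tr_add tr_scale) simp
  qed
  have perp: "tr (v * (y + emb t * v)) = tr (v * y)" "tr (v * (y - emb t * v)) = tr (v * y)" for y t
    using v by (simp_all add: distrib_left right_diff_distrib tr_add tr_diff tr_scale_right power2_eq_square)
  have trans_diff: "tr ((y - emb t * v)\<^sup>2) + 2 * t * tr (v * y) = tr (y\<^sup>2)" for y t
    using trans[of "y - emb t * v" t] by (simp only: perp diff_add_cancel)
  have shift: "(\<Sum>y\<in>?B. g (tr (y\<^sup>2))) = (\<Sum>y\<in>?B. g (tr (y\<^sup>2) + 2 * t * tr (v * y)))" for t
    by (rule sum.reindex_bij_witness[of _ "\<lambda>y. y + emb t * v" "\<lambda>y. y - emb t * v"])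
      (auto simp: perp trans_diff)
  have "(int CARD('a)) * (\<Sum>y\<in>?B. g (tr (y\<^sup>2))) = (\<Sum>t\<in>(UNIV::'a set). \<Sum>y\<in>?B. g (tr (y\<^sup>2)))"
    by simp
  also have "\<dots> = (\<Sum>t\<in>UNIV. \<Sum>y\<in>?B. g (tr (y\<^sup>2) + 2 * t * tr (v * y)))"
    by (rule sum.cong[OF refl shift])
  also have "\<dots> = (\<Sum>y\<in>?B. \<Sum>t\<in>UNIV. g (tr (y\<^sup>2) + 2 * t * tr (v * y)))"
    by (rule sum.swap)
  also have "\<dots> = (\<Sum>y\<in>?B. \<Sum>c\<in>UNIV. g c)"
  proof (rule sum.cong[OF refl])
    fix y assume y: "y \<in> ?B"
    show "(\<Sum>t\<in>UNIV. g (tr (y\<^sup>2) + 2 * t * tr (v * y))) = (\<Sum>c\<in>UNIV. g c)"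
      by (rule sum.reindex_bij_witness[of _ "\<lambda>c. (c - tr (y\<^sup>2)) / (2 * tr (v * y))"
            "\<lambda>t. tr (y\<^sup>2) + 2 * t * tr (v * y)"])
        (use y two_F in \<open>auto simp: field_simps\<close>)
  qed
  also have "\<dots> = int (card ?B) * (\<Sum>c\<in>UNIV. g c)"
    by simp
  also have "int (card ?B) = (int CARD('a)) ^ 3 - (int CARD('a))\<^sup>2"
  proof -
    have "?B = UNIV - {y. tr (v * y) = 0}" by auto
    then have "card ?B = CARD('a cubic_ext) - card {y. tr (v * y) = 0}"
      by (simp add: card_Diff_subset)
    also have "\<dots> = CARD('a) ^ 3 - CARD('a)\<^sup>2"
      using card_tr_eq[OF v(1)] by (simp add: card_cubic_ext)
    finally show ?thesis
      by (simp add: of_nat_diff power_increasing)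
  qed
  also have "((int CARD('a)) ^ 3 - (int CARD('a))\<^sup>2) * (\<Sum>c\<in>UNIV. g c) = (int CARD('a)) * (((int CARD('a))\<^sup>2 - (int CARD('a))) * (\<Sum>c\<in>UNIV. g c))"
    by (simp add: algebra_simps power2_eq_square power3_eq_cube)
  finally show ?thesis by simp
qed

lemma card_isotropic_nonperp:
  fixes v :: "'a cubic_ext"
  assumes v: "v \<noteq> 0" "tr (v\<^sup>2) = 0"
  shows "int (card {r. tr (v * r) \<noteq> 0 \<and> tr (r\<^sup>2) = 0}) = (int CARD('a))\<^sup>2 - (int CARD('a))"
proof -
  have "{r. tr (v * r) \<noteq> 0 \<and> tr (r\<^sup>2) = 0} = {r. tr (v * r) \<noteq> 0} \<inter> {r. tr (r\<^sup>2) = 0}"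
    by auto
  then show ?thesis
    using sum_tr_square_nonperp[OF v, of "\<lambda>c. of_bool (c = 0)"] by simp
qed

text \<open>The tangent to the conic at v meets it only there: of the q^2 isotropic elements q^2 - q
  are not perpendicular to v, which leaves room only for the q multiples of v.\<close>

lemma isotropic_perp:
  fixes v :: "'a cubic_ext"
  assumes v: "v \<noteq> 0" "tr (v\<^sup>2) = 0"
  shows "{r. tr (v * r) = 0 \<and> tr (r\<^sup>2) = 0} = range (\<lambda>c. emb c * v)"
proof (rule card_subset_eq[symmetric])
  let ?A = "{r. tr (v * r) = 0 \<and> tr (r\<^sup>2) = 0}" and ?B = "{r. tr (v * r) \<noteq> 0 \<and> tr (r\<^sup>2) = 0}"
  show "finite ?A" by simp
  show "range (\<lambda>c. emb c * v) \<subseteq> ?A"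
    using v by (auto simp: tr_scale_right tr_scale power2_eq_square mult.assoc)
  have "card ?A + card ?B = card (?A \<union> ?B)"
    by (rule card_Un_disjoint[symmetric]) auto
  also have "?A \<union> ?B = {r. tr (r\<^sup>2) = 0}" by auto
  finally have "card ?A + card ?B = CARD('a)\<^sup>2"
    unfolding card_isotropic .
  then have "int (card ?A) + int (card ?B) = (int CARD('a))\<^sup>2"
    unfolding of_nat_add[symmetric] of_nat_power[symmetric] by (rule arg_cong)
  then have "card ?A = CARD('a)"
    unfolding card_isotropic_nonperp[OF v] by simp
  then show "card (range (\<lambda>c. emb c * v)) = card ?A"
    using v by (simp add: card_image inj_on_def)
qed

lemma ex_isotropic: "\<exists>v :: 'a cubic_ext. v \<noteq> 0 \<and> tr (v\<^sup>2) = 0"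
proof (rule ccontr)
  assume "\<nexists>v :: 'a cubic_ext. v \<noteq> 0 \<and> tr (v\<^sup>2) = 0"
  then have "{r :: 'a cubic_ext. tr (r\<^sup>2) = 0} = {0}" by auto
  then have "CARD('a)\<^sup>2 = 1" using card_isotropic by simp
  then show False using card_field_ge_2[where 'a='a] by simp
qed

text \<open>With v isotropic and perpendicular to m, the Gram determinant of v, m, s collapses to -
  tr(m^2) tr(v s)^2. It is a square, and so is -1.\<close>

lemma qchar_tr_square_perp:
  fixes v m :: "'a cubic_ext"
  assumes v: "v \<noteq> 0" "tr (v\<^sup>2) = 0" and m: "tr (v * m) = 0"
  shows "qchar (tr (m\<^sup>2)) = of_bool (tr (m\<^sup>2) \<noteq> 0)"
proof (cases "tr (m\<^sup>2) = 0")
  case False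
  obtain s where s: "tr (v * s) \<noteq> 0" using ex_tr_mult_nonzero[OF v(1)] by blast
  obtain d where d: "d\<^sup>2 = - tr (m\<^sup>2) * (tr (v * s))\<^sup>2"
    using tr_gram_square[of v m s] v(2) m by auto
  then have "- tr (m\<^sup>2) = (d / tr (v * s))\<^sup>2"
    using s by (simp add: power_divide)
  then have "qchar (- tr (m\<^sup>2)) = 1"
    using False by (metis neg_equal_0_iff_equal qchar_square zero_power2)
  then show ?thesis using False by (simp add: qchar_minus_F)
qed simp

section \<open>Character sums along the trace\<close>

lemma sum_qchar_tr_square:
  "(\<Sum>x\<in>(UNIV :: 'a cubic_ext set). qchar (tr (x\<^sup>2))) = (int CARD('a))\<^sup>2 - (int CARD('a))"
proof -
  obtain v :: "'a cubic_ext" where v: "v \<noteq> 0" "tr (v\<^sup>2) = 0" using ex_isotropic by blast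
  let ?A = "{x. tr (v * x) = 0}"
  \<comment> \<open>Off the hyperplane perpendicular to v the values are equidistributed and cancel;
    on it every nonzero value is a square, and only the q multiples of v give 0.\<close>
  have U: "UNIV = ?A \<union> {x. tr (v * x) \<noteq> 0}" by auto
  have "(\<Sum>x\<in>(UNIV :: 'a cubic_ext set). qchar (tr (x\<^sup>2))) =
      (\<Sum>x\<in>?A. qchar (tr (x\<^sup>2))) + (\<Sum>x | tr (v * x) \<noteq> 0. qchar (tr (x\<^sup>2)))"
    unfolding U by (rule sum.union_disjoint) auto
  also have "(\<Sum>x | tr (v * x) \<noteq> 0. qchar (tr (x\<^sup>2))) = 0"
    using sum_tr_square_nonperp[OF v, of qchar] sum_qchar[OF two_F] by simp
  also have "(\<Sum>x\<in>?A. qchar (tr (x\<^sup>2))) = (\<Sum>x\<in>?A. 1 - of_bool (tr (x\<^sup>2) = 0))"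
    by (rule sum.cong) (auto simp: qchar_tr_square_perp[OF v])
  also have "\<dots> = int (card ?A) - int (card (?A \<inter> {x. tr (x\<^sup>2) = 0}))"
    by (simp add: sum_subtractf)
  also have "?A \<inter> {x. tr (x\<^sup>2) = 0} = range (\<lambda>c. emb c * v)"
    using isotropic_perp[OF v] by auto
  also have "card \<dots> = CARD('a)"
    using v by (simp add: card_image inj_on_def)
  also have "card ?A = CARD('a)\<^sup>2"
    by (rule card_tr_eq[OF v(1)])
  finally show ?thesis by simp
qed

text \<open>Scaling by elements of F shows that the sum \<open>H c\<close> is eta(c) times
  \<open>H 1\<close>, where a nonsquare factor forces \<open>H 0 = 0\<close>. The constant
  \<open>H 1\<close> comes from evaluating the sum of eta(tr(x^2)) a second time, through u =
  x^2.\<close>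

lemma sum_qchar_tr_eq:
  fixes c :: 'a
  shows "(\<Sum>u\<in>UNIV. qchar u * of_bool (tr u = c)) = (int CARD('a)) * qchar c"
proof -
  define H where "H c = (\<Sum>u\<in>UNIV. qchar u * of_bool (tr u = c))" for c :: 'a
  have scale: "H (d * c) = qchar d * H c" if d: "d \<noteq> 0" for c d
    unfolding H_def sum_distrib_left
    by (rule sym, rule sum.reindex_bij_witness[of _ "\<lambda>u. u / emb d" "\<lambda>u. emb d * u"])
      (use d in \<open>auto simp: tr_scale qchar_mult_E qchar_emb\<close>)
  obtain n :: 'a where n: "qchar n = - 1" using ex_nonsquare[OF two_F] by blast
  have H0: "H 0 = 0"
    using scale[of n 0] n by fastforce
  have Hc: "H c = qchar c * H 1" for c
    using scale[of c 1] H0 by (cases "c = 0") auto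
  have qqH: "qchar c * H c = H 1" if "c \<noteq> 0" for c
    using that by (subst Hc) (simp flip: mult.assoc)
  have group: "(\<Sum>u\<in>(UNIV :: 'a cubic_ext set). f u * qchar (tr u)) =
      (\<Sum>c\<in>UNIV. qchar c * (\<Sum>u\<in>UNIV. f u * of_bool (tr u = c)))" for f
  proof -
    have "(\<Sum>u\<in>(UNIV :: 'a cubic_ext set). f u * qchar (tr u)) =
        (\<Sum>u\<in>(UNIV :: 'a cubic_ext set). \<Sum>c\<in>UNIV. qchar c * (f u * of_bool (tr u = c)))"
      by (rule sum.cong) (auto simp: if_distrib[of "\<lambda>t. _ * t"] of_bool_def cong: if_cong)
    also have "\<dots> = (\<Sum>c\<in>UNIV. \<Sum>u\<in>UNIV. qchar c * (f u * of_bool (tr u = c)))"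
      by (rule sum.swap)
    finally show ?thesis by (simp only: sum_distrib_left)
  qed
  have "(int CARD('a))\<^sup>2 - (int CARD('a)) = (\<Sum>x\<in>(UNIV :: 'a cubic_ext set). qchar (tr (x\<^sup>2)))"
    by (rule sum_qchar_tr_square[symmetric])
  also have "\<dots> = (\<Sum>u\<in>UNIV. (1 + qchar u) * qchar (tr (u :: 'a cubic_ext)))"
    by (rule sum_squares_eq[OF two_E])
  also have "\<dots> = (\<Sum>u\<in>UNIV. 1 * qchar (tr (u :: 'a cubic_ext))) +
      (\<Sum>u\<in>UNIV. qchar u * qchar (tr (u :: 'a cubic_ext)))"
    by (simp add: sum.distrib distrib_right)
  also have "(\<Sum>u\<in>UNIV. 1 * qchar (tr (u :: 'a cubic_ext))) = (\<Sum>c\<in>UNIV. qchar (c :: 'a) * (int CARD('a))\<^sup>2)"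
    unfolding group using card_tr_eq[of "1 :: 'a cubic_ext"] by simp
  also have "\<dots> = 0"
    using sum_qchar[OF two_F] by (simp flip: sum_distrib_right)
  also have "(\<Sum>u\<in>UNIV. qchar u * qchar (tr (u :: 'a cubic_ext))) = (\<Sum>c\<in>UNIV. qchar c * H c)"
    unfolding group H_def ..
  also have "\<dots> = (\<Sum>c\<in>UNIV - {0::'a}. H 1)"
    by (rule sum.mono_neutral_cong_right) (auto simp: H0 qqH)
  also have "\<dots> = ((int CARD('a)) - 1) * H 1"
    by (simp add: card_Diff_singleton of_nat_diff Suc_leI)
  finally have "((int CARD('a)) - 1) * H 1 = ((int CARD('a)) - 1) * (int CARD('a))"
    by (simp add: power2_eq_square algebra_simps)
  then have "H 1 = (int CARD('a))"
    using card_field_ge_2[where 'a='a] by simp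
  then show ?thesis
    using Hc[of c] by (simp add: H_def mult.commute)
qed

end

section \<open>Salie sums and the sign function\<close>

text \<open>The fibre over s consists of the roots of X^2 - s X + 1; away from s = 2 and s = -2
  there are 1 + eta((s + 2)(s - 2)) of them, and (x + 1)^2 = x (s + 2) forces eta(x) = eta(s + 2) on
  it.\<close>

lemma sum_qchar_salie:
  fixes g :: "'b::{field,finite} \<Rightarrow> int"
  assumes q1: "CARD('b) mod 4 = 1"
  shows "(\<Sum>x\<in>UNIV. qchar x * g (x + 1 / x)) = (\<Sum>s\<in>UNIV. (qchar (s + 2) + qchar (s - 2)) * g s)"
proof -
  note two = two_nonzero[OF q1]
  have four: "(4::'b) = 2\<^sup>2" by simp
  have four0: "(4::'b) \<noteq> 0" unfolding four by (rule power_not_zero[OF two])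
  have q4: "qchar (4::'b) = 1" unfolding four by (rule qchar_square[OF two])
  have fib: "(\<Sum>x | x \<noteq> 0 \<and> x + 1 / x = s. qchar x) = qchar (s + 2) + qchar (s - 2)" for s :: 'b
  proof -
    let ?S = "{x. x \<noteq> 0 \<and> x + 1 / x = s}"
    have quad: "x \<in> ?S \<longleftrightarrow> x * x - s * x + 1 = 0" for x
      by (cases "x = 0") (auto simp: field_simps)
    \<comment> \<open>The double roots 1 and -1 are treated apart; for -1 the value eta(-4) = 1 uses
      that -1 is a square.\<close>
    consider "s = 2" | "s = - 2" | "s + 2 \<noteq> 0" "s - 2 \<noteq> 0"
      by (metis add_eq_0_iff2 eq_iff_diff_eq_0)
    then show ?thesis
    proof cases
      case 1
      have "x * x - s * x + 1 = (x - 1) * (x - 1)" for x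
        unfolding 1 by (simp add: algebra_simps)
      then have "?S = {1}"
        using quad by auto
      then show ?thesis using 1 q4 by simp
    next
      case 2
      have "x * x - s * x + 1 = (x + 1) * (x + 1)" for x
        unfolding 2 by (simp add: algebra_simps)
      then have "?S = {- 1}"
        using quad by (auto simp: eq_neg_iff_add_eq_0)
      then show ?thesis using 2 q4 qchar_minus[OF q1, of 4] qchar_minus_1[OF q1] by simp
    next
      case 3
      have sq: "x * x - s * x + 1 = 0 \<longleftrightarrow> (2 * x - s)\<^sup>2 = (s + 2) * (s - 2)" for x
      proof -
        have "(2 * x - s)\<^sup>2 - (s + 2) * (s - 2) = 4 * (x * x - s * x + 1)"
          by (simp add: power2_eq_square algebra_simps)
        then show ?thesis using four0 by (metis eq_iff_diff_eq_0 mult_eq_0_iff)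
      qed
      have S_eq: "?S = {x. (2 * x - s)\<^sup>2 = (s + 2) * (s - 2)}"
        using quad sq by blast
      have half: "2 * ((y + s) / 2) - s = y" for y
        using two by (simp add: add_divide_distrib)
      have "bij_betw (\<lambda>x. 2 * x - s) ?S {y. y\<^sup>2 = (s + 2) * (s - 2)}"
        unfolding S_eq
        by (rule bij_betw_byWitness[where f' = "\<lambda>y. (y + s) / 2"])
          (use two in \<open>auto simp: half simp del: times_divide_eq_right\<close>)
      then have card: "int (card ?S) = 1 + qchar (s + 2) * qchar (s - 2)"
        using card_square_roots[OF two, of "(s + 2) * (s - 2)"] qchar_mult[OF two]
        by (simp add: bij_betw_same_card)
      have "qchar x = qchar (s + 2)" if "x \<in> ?S" for x
      proof -
        from that have x: "x \<noteq> 0" "s = x + 1 / x" by auto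
        have sx: "(x + 1)\<^sup>2 = x * (s + 2)"
          using x by (simp add: power2_eq_square field_simps)
        moreover have "x + 1 \<noteq> 0"
          using sx x(1) 3(1) by auto
        ultimately have "qchar x * qchar (s + 2) = 1"
          by (metis qchar_mult[OF two] qchar_square)
        then show ?thesis
          using qchar_cases[OF x(1)] qchar_cases[OF 3(1)] by auto
      qed
      then have "(\<Sum>x\<in>?S. qchar x) = int (card ?S) * qchar (s + 2)"
        by simp
      then show ?thesis
        unfolding card using qchar_cases[OF 3(1)] by (auto simp: algebra_simps)
    qed
  qed
  \<comment> \<open>The element x = 0, where 1 / x is 0 by convention, carries the weight
    \<open>qchar 0 = 0\<close>.\<close>
  have "(\<Sum>x\<in>UNIV. qchar x * g (x + 1 / x)) = (\<Sum>x\<in>UNIV - {0}. qchar x * g (x + 1 / x))"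
    by (rule sum.mono_neutral_right) auto
  also have "\<dots> = (\<Sum>s\<in>UNIV. \<Sum>x\<in>{x \<in> UNIV - {0}. x + 1 / x = s}. qchar x * g (x + 1 / x))"
    by (subst sum.group) auto
  also have "\<dots> = (\<Sum>s\<in>UNIV. (\<Sum>x | x \<noteq> 0 \<and> x + 1 / x = s. qchar x) * g s)"
    unfolding sum_distrib_right by (intro sum.cong) auto
  finally show ?thesis unfolding fib .
qed

text \<open>The substitution x -> b / (a x) exchanges the two summands x a and b / x, while eta(x)
  changes sign because a b is a nonsquare.\<close>

lemma sum_qchar_nonsquare_eq_0:
  fixes a b :: "'b::{field,finite}" and g :: "'b \<Rightarrow> int"
  assumes two: "(2::'b) \<noteq> 0" and ab: "qchar (a * b) = - 1"
  shows "(\<Sum>x\<in>UNIV. qchar x * g (x * a + b / x)) = 0"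
proof -
  have a: "a \<noteq> 0" and b: "b \<noteq> 0" using ab by auto
  have "qchar (b / (a * x)) = - qchar x" if "x \<noteq> 0" for x
  proof -
    have "b / (a * x) * (a * x)\<^sup>2 = x * (a * b)"
      using a that by (simp add: power2_eq_square)
    then have "qchar (b / (a * x)) * qchar ((a * x)\<^sup>2) = qchar x * qchar (a * b)"
      by (metis qchar_mult[OF two])
    then show ?thesis using a that ab by (simp add: qchar_square)
  qed
  then have "(\<Sum>x\<in>UNIV - {0}. qchar x * g (x * a + b / x)) =
      (\<Sum>x\<in>UNIV - {0}. - (qchar x * g (x * a + b / x)))"
    by (intro sum.reindex_bij_witness[of _ "\<lambda>x. b / (a * x)" "\<lambda>x. b / (a * x)"])
      (use a b in \<open>auto simp: add.commute mult.commute\<close>)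
  then have "(\<Sum>x\<in>UNIV - {0}. qchar x * g (x * a + b / x)) = 0"
    by (simp add: sum_negf)
  moreover have "(\<Sum>x\<in>UNIV. qchar x * g (x * a + b / x)) = (\<Sum>x\<in>UNIV - {0}. qchar x * g (x * a + b / x))"
    by (rule sum.mono_neutral_right) auto
  ultimately show ?thesis by simp
qed

context field_card_1_mod_4
begin

text \<open>Replacing x by x r / v turns the argument into k (x + 1/x) with k = r v. The Salie
  reduction then leaves the sums of eta(u) over tr(u) = tr(2 k) and over tr(u) = - tr(2 k), which
  agree because -1 is a square; hence the factor 2.\<close>

lemma sum_qchar_salie_tr:
  fixes r v :: "'a cubic_ext"
  assumes "r \<noteq> 0" "v \<noteq> 0"
  shows "(\<Sum>x\<in>UNIV. qchar x * of_bool (tr (x * v\<^sup>2 + r\<^sup>2 / x) = 0)) =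
    2 * int CARD('a) * qchar (2::'a) * qchar (tr (r * v))"
proof -
  define k where "k = r * v"
  have k: "k \<noteq> 0" using assms by (simp add: k_def)
  have H: "(\<Sum>s\<in>UNIV. qchar (k * (s + t)) * of_bool (tr (k * s) = 0)) =
      int CARD('a) * qchar (tr (k * t))" for t
  proof -
    have "(\<Sum>s\<in>UNIV. qchar (k * (s + t)) * of_bool (tr (k * s) = 0)) =
        (\<Sum>u\<in>UNIV. qchar u * of_bool (tr u = tr (k * t)))"
      by (rule sum.reindex_bij_witness[of _ "\<lambda>u. u / k - t" "\<lambda>s. k * (s + t)"])
        (use k in \<open>auto simp: distrib_left tr_add add_divide_distrib\<close>)
    then show ?thesis by (simp only: sum_qchar_tr_eq)
  qed
  have "(\<Sum>x\<in>UNIV. qchar x * of_bool (tr (x * v\<^sup>2 + r\<^sup>2 / x) = 0)) =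
      (\<Sum>x\<in>UNIV. qchar (x * (r / v)) * of_bool (tr (k * (x + 1 / x)) = 0))"
    by (rule sum.reindex_bij_witness[of _ "\<lambda>x. x * (r / v)" "\<lambda>x. x * (v / r)"])
      (use assms in \<open>auto simp: k_def power2_eq_square distrib_left mult_ac\<close>)
  also have "\<dots> = (\<Sum>x\<in>UNIV. qchar x * (qchar k * of_bool (tr (k * (x + 1 / x)) = 0)))"
  proof (rule sum.cong[OF refl])
    fix x :: "'a cubic_ext"
    have "qchar (r / v) = qchar k"
      using qchar_mult_square[of v "r / v"] assms by (simp add: k_def power2_eq_square mult_ac)
    then show "qchar (x * (r / v)) * of_bool (tr (k * (x + 1 / x)) = 0) =
        qchar x * (qchar k * of_bool (tr (k * (x + 1 / x)) = 0))"
      by (simp only: qchar_mult_E mult.assoc)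
  qed
  also have "\<dots> = (\<Sum>s\<in>UNIV. (qchar (s + 2) + qchar (s - 2)) * (qchar k * of_bool (tr (k * s) = 0)))"
    by (rule sum_qchar_salie[OF card_ext_mod_4])
  also have "\<dots> = (\<Sum>s\<in>UNIV. qchar (k * (s + 2)) * of_bool (tr (k * s) = 0)) +
      (\<Sum>s\<in>UNIV. qchar (k * (s + - 2)) * of_bool (tr (k * s) = 0))"
    by (simp only: sum.distrib[symmetric] qchar_mult_E) (simp add: algebra_simps)
  also have "\<dots> = int CARD('a) * qchar (tr (k * 2)) + int CARD('a) * qchar (tr (k * - 2))"
    by (simp only: H)
  also have "tr (k * 2) = 2 * tr k"
    using tr_scale[of 2 k] by (simp add: mult.commute)
  also have "tr (k * - 2) = - (2 * tr k)"
    using tr_scale[of 2 k] by (simp add: mult.commute tr_minus)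
  finally show ?thesis
    by (simp add: qchar_minus_F qchar_mult_F k_def)
qed

section \<open>The sign on the isotropic cone\<close>

definition v0 :: "'a cubic_ext" where
  "v0 = (SOME v. v \<noteq> 0 \<and> tr (v\<^sup>2) = 0)"

lemma v0: "v0 \<noteq> 0" "tr (v0\<^sup>2) = 0"
  using someI_ex[OF ex_isotropic] by (auto simp: v0_def)

text \<open>
  Up to a global sign, this is the quadratic character of the scalar when an isotropic element is
  written as a scalar times a value of a fixed quadratic parametrisation of the conic.  The value at
  multiples of the base point \<open>v0\<close> is forced by the rule for $\eta(T(rs))$.
\<close>

definition conic_sign :: "'a cubic_ext \<Rightarrow> int" where
  "conic_sign r = (if tr (r\<^sup>2) \<noteq> 0 then 0
     else if tr (v0 * r) \<noteq> 0 then qchar (tr (v0 * r))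
     else qchar (2::'a) * qchar (r / v0))"

lemma conic_sign_0 [simp]: "conic_sign 0 = 0"
  by (simp add: conic_sign_def)

lemma conic_sign_cases: "r \<noteq> 0 \<Longrightarrow> tr (r\<^sup>2) = 0 \<Longrightarrow> conic_sign r = 1 \<or> conic_sign r = - 1"
  using qchar_cases[of "tr (v0 * r)"] qchar_cases[of "r / v0"] qchar_cases[OF two_F] v0(1)
  by (auto simp: conic_sign_def)

lemma conic_sign_square: "r \<noteq> 0 \<Longrightarrow> tr (r\<^sup>2) = 0 \<Longrightarrow> conic_sign r * conic_sign r = 1"
  using conic_sign_cases by fastforce

lemma conic_sign_eq_0_iff: "conic_sign r = 0 \<longleftrightarrow> r = 0 \<or> tr (r\<^sup>2) \<noteq> 0"
  using conic_sign_cases[of r] by (cases "r = 0") (auto simp: conic_sign_def)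

lemma conic_sign_scale: "conic_sign (emb c * r) = qchar c * conic_sign r"
proof (cases "c = 0")
  case False
  have "tr ((emb c * r)\<^sup>2) = c\<^sup>2 * tr (r\<^sup>2)"
    using tr_scale[of "c\<^sup>2" "r\<^sup>2"] by (simp add: power_mult_distrib)
  moreover have "qchar (emb c * r / v0) = qchar c * qchar (r / v0)"
    using qchar_mult_E[of "emb c" "r / v0"] by (simp add: qchar_emb)
  ultimately show ?thesis
    using False by (simp add: conic_sign_def tr_scale_right qchar_mult_F)
qed simp

text \<open>Makes a sign on squares r^2 well defined, where r is determined only up to sign.\<close>

lemma conic_sign_minus: "conic_sign (- r) = conic_sign r"
  using conic_sign_scale[of "- 1" r] qchar_minus_1[OF q1] by simp

text \<open>For isotropic \<open>v0\<close>, r, s the Gram determinant reduces to 2 tr(v0 r) tr(r s)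
  tr(v0 s), and it is a square; this ties the three characters together. If r or s is a multiple of
  \<open>v0\<close>, the determinant vanishes and the factor eta(2) built into the sign of such
  multiples gives the claim directly.\<close>

lemma qchar_tr_isotropic:
  fixes r s :: "'a cubic_ext"
  assumes r: "tr (r\<^sup>2) = 0" and s: "tr (s\<^sup>2) = 0" and rs: "tr (r * s) \<noteq> 0"
  shows "qchar (tr (r * s)) = qchar (2::'a) * conic_sign r * conic_sign s"
proof -
  have perp: "qchar (tr (r * s)) = qchar (2::'a) * conic_sign r * conic_sign s"
    if r: "tr (r\<^sup>2) = 0" and s: "tr (s\<^sup>2) = 0" and rs: "tr (r * s) \<noteq> 0" and r0: "tr (v0 * r) = 0"
    for r s :: "'a cubic_ext"
  proof -
    obtain c where c: "r = emb c * v0"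
      using isotropic_perp[OF v0] r r0 by blast
    have "c * tr (v0 * s) \<noteq> 0"
      using rs unfolding c mult.assoc tr_scale .
    moreover have "conic_sign r = qchar (2::'a) * qchar c"
      using r r0 v0(1) by (simp add: conic_sign_def c qchar_emb)
    moreover have "qchar (tr (r * s)) = qchar c * qchar (tr (v0 * s))"
      unfolding c mult.assoc tr_scale by (rule qchar_mult_F)
    moreover have "qchar (2::'a) * qchar (2::'a) = 1" by (rule qchar_F_square[OF two_F])
    ultimately show ?thesis
      using s by (simp add: conic_sign_def)
  qed
  consider "tr (v0 * r) = 0" | "tr (v0 * s) = 0" | "tr (v0 * r) \<noteq> 0" "tr (v0 * s) \<noteq> 0"
    by blast
  then show ?thesis
  proof cases
    case 1
    then show ?thesis by (rule perp[OF r s rs])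
  next
    case 2
    then show ?thesis using perp[OF s r] rs by (simp add: mult_ac)
  next
    case 3
    obtain d where d: "d\<^sup>2 = 2 * tr (v0 * r) * tr (r * s) * tr (v0 * s)"
      using tr_gram_square[of v0 r s] v0 r s by auto
    have "d \<noteq> 0"
      using d 3 rs two_F by auto
    then have "qchar (2 * tr (v0 * r) * tr (r * s) * tr (v0 * s)) = 1"
      by (metis d qchar_square)
    then have "qchar (2::'a) * qchar (tr (v0 * r)) * qchar (tr (r * s)) * qchar (tr (v0 * s)) = 1"
      by (simp only: qchar_mult_F)
    then show ?thesis
      using r s 3 qchar_cases[OF 3(1)] qchar_cases[OF 3(2)] qchar_cases[OF two_F] qchar_cases[OF rs]
      by (auto simp: conic_sign_def)
  qed
qed

text \<open>Every nonzero term equals eta(2) epsilon(v), since epsilon(r)^2 = 1; these terms belong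
  to the q^2 - q isotropic r that are not perpendicular to v.\<close>

lemma sum_conic_sign_tr:
  assumes v: "v \<noteq> 0" "tr (v\<^sup>2) = 0"
  shows "(\<Sum>r\<in>UNIV. conic_sign r * qchar (tr (r * v))) =
    ((int CARD('a))\<^sup>2 - int CARD('a)) * (qchar (2::'a) * conic_sign v)"
proof -
  let ?B = "{r. tr (v * r) \<noteq> 0 \<and> tr (r\<^sup>2) = 0}"
  have "(\<Sum>r\<in>UNIV. conic_sign r * qchar (tr (r * v))) = (\<Sum>r\<in>?B. qchar (2::'a) * conic_sign v)"
  proof (rule sum.mono_neutral_cong_right)
    show "\<forall>r\<in>UNIV - ?B. conic_sign r * qchar (tr (r * v)) = 0"
      by (auto simp: conic_sign_def mult.commute)
  next
    fix r assume "r \<in> ?B"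
    then have r: "tr (r * v) \<noteq> 0" "tr (r\<^sup>2) = 0" by (simp_all add: mult.commute)
    then have "r \<noteq> 0" by auto
    then have "conic_sign r * conic_sign r = 1" using r by (simp add: conic_sign_square)
    then show "conic_sign r * qchar (tr (r * v)) = qchar (2::'a) * conic_sign v"
      unfolding qchar_tr_isotropic[OF r(2) v(2) r(1)] by (simp add: mult.left_commute)
  qed auto
  then show ?thesis by (simp add: card_isotropic_nonperp[OF v])
qed

section \<open>The sign on elements of trace zero\<close>

definition nonsq :: 'a where
  "nonsq = (SOME n. qchar n = - 1)"

lemma qchar_nonsq: "qchar nonsq = - 1"
  using someI_ex[OF ex_nonsquare[OF two_F]] by (simp add: nonsq_def)

lemma nonsq_nonzero: "nonsq \<noteq> 0"
  using qchar_nonsq by auto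

text \<open>The chosen root is ambiguous only up to sign, which \<open>conic_sign\<close> ignores.
  The element 0 falls into the second branch and gets the value 0.\<close>

definition tr0_sign :: "'a cubic_ext \<Rightarrow> int" where
  "tr0_sign z = conic_sign (if qchar z = 1 then SOME r. z = r\<^sup>2 else SOME r. z = emb nonsq * r\<^sup>2)"

lemma tr0_sign_square: "tr0_sign (r\<^sup>2) = conic_sign r"
proof (cases "r = 0")
  case True
  then show ?thesis
    by (auto simp: tr0_sign_def nonsq_nonzero)
next
  case False
  have "r\<^sup>2 = (SOME s. r\<^sup>2 = s\<^sup>2)\<^sup>2"
    by (rule someI[of "\<lambda>s. r\<^sup>2 = s\<^sup>2" r]) simp
  then have "(SOME s. r\<^sup>2 = s\<^sup>2) = r \<or> (SOME s. r\<^sup>2 = s\<^sup>2) = - r"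
    by (metis power2_eq_iff)
  then show ?thesis
    using False by (auto simp: tr0_sign_def qchar_square conic_sign_minus)
qed

lemma tr0_sign_nonsquare: "tr0_sign (emb nonsq * r\<^sup>2) = conic_sign r"
proof (cases "r = 0")
  case True
  then show ?thesis using tr0_sign_square[of 0] by simp
next
  case False
  let ?z = "emb nonsq * r\<^sup>2"
  define s where "s = (SOME s. ?z = emb nonsq * s\<^sup>2)"
  have "?z = emb nonsq * s\<^sup>2"
    unfolding s_def by (rule someI[of "\<lambda>s. ?z = emb nonsq * s\<^sup>2" r]) simp
  then have "s = r \<or> s = - r"
    using nonsq_nonzero by (auto simp: power2_eq_iff)
  moreover have "qchar ?z = - 1"
    using False by (simp add: qchar_mult_E qchar_emb qchar_nonsq qchar_square)
  then have "tr0_sign ?z = conic_sign s"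
    unfolding tr0_sign_def s_def by (subst if_not_P) auto
  ultimately show ?thesis
    by (auto simp: conic_sign_minus)
qed

lemma square_classes: "(\<exists>r. z = r\<^sup>2) \<or> (\<exists>r. z = emb nonsq * r\<^sup>2)" for z :: "'a cubic_ext"
proof (cases "z = 0 \<or> qchar z = 1")
  case True
  then show ?thesis
    by (metis qchar_def neg_equal_iff_equal one_neq_neg_one power_zero_numeral)
next
  case False
  then have "qchar (emb nonsq * z) = 1"
    using qchar_cases[of z] by (auto simp: qchar_mult_E qchar_emb qchar_nonsq)
  then obtain r where "emb nonsq * z = r\<^sup>2"
    by (metis qchar_def zero_neq_one one_neq_neg_one)
  then have "z = emb nonsq * (r / emb nonsq)\<^sup>2"
    using nonsq_nonzero by (simp add: power2_eq_square field_simps)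
  then show ?thesis by blast
qed

lemma tr0_sign_eq_0_iff: "tr0_sign z = 0 \<longleftrightarrow> z = 0 \<or> tr z \<noteq> 0"
  using square_classes[of z] nonsq_nonzero tr0_sign_square[of 0]
  by (auto simp: tr0_sign_square tr0_sign_nonsquare conic_sign_eq_0_iff tr_scale)

lemma tr0_sign_cases:
  assumes "z \<noteq> 0" "tr z = 0"
  shows "tr0_sign z = 1 \<or> tr0_sign z = - 1"
proof -
  obtain r where r: "z = r\<^sup>2 \<or> z = emb nonsq * r\<^sup>2"
    using square_classes[of z] by blast
  then have "tr0_sign z = conic_sign r"
    by (auto simp: tr0_sign_square tr0_sign_nonsquare)
  moreover have "r \<noteq> 0" "tr (r\<^sup>2) = 0"
    using r assms nonsq_nonzero by (auto simp: tr_scale)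
  ultimately show ?thesis
    using conic_sign_cases by simp
qed

text \<open>If r represents z in its square class, then c r represents c^2 z, and the sign of the
  cone picks up eta(c). This factor later cancels the one from eta(c x).\<close>

lemma tr0_sign_scale: "tr0_sign ((emb c)\<^sup>2 * z) = qchar c * tr0_sign z"
proof -
  from square_classes[of z] consider r where "z = r\<^sup>2" | r where "z = emb nonsq * r\<^sup>2"
    by blast
  then show ?thesis
  proof cases
    case 1
    then show ?thesis
      using tr0_sign_square[of "emb c * r"] by (simp add: tr0_sign_square conic_sign_scale power_mult_distrib)
  next
    case 2
    then have "(emb c)\<^sup>2 * z = emb nonsq * (emb c * r)\<^sup>2"
      by (simp add: power_mult_distrib mult_ac)
    then show ?thesis
      unfolding 2 by (simp only: tr0_sign_nonsquare conic_sign_scale)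
  qed
qed

lemma sum_tr0_sign:
  "(\<Sum>r\<in>UNIV. conic_sign r * h (r\<^sup>2)) + (\<Sum>r\<in>UNIV. conic_sign r * h (emb nonsq * r\<^sup>2)) =
    2 * (\<Sum>z\<in>UNIV. tr0_sign z * h z)"
  using sum_two_classes[OF qchar_nonsq, of "\<lambda>z. tr0_sign z * h z"]
  by (simp add: tr0_sign_square tr0_sign_nonsquare)

text \<open>The parametrisations z = r^2 and z = n r^2 split the sum into \<open>A\<close> and
  \<open>B\<close>. If z and w lie in different square classes, the sum over x vanishes by
  inversion; otherwise it is the evaluated Salie sum, and summing it over r against the sign of the
  cone reproduces the sign of w.\<close>

lemma sum_tr0_sign_eigen:
  fixes w :: "'a cubic_ext"
  assumes w: "w \<noteq> 0" "tr w = 0"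
  shows "(\<Sum>x\<in>UNIV. \<Sum>z\<in>UNIV. qchar x * (tr0_sign z * of_bool (tr (x * w + z / x) = 0))) =
    ((int CARD('a)) ^ 3 - (int CARD('a))\<^sup>2) * tr0_sign w"
proof -
  let ?q = "int CARD('a)"
  define A where "A r = (\<Sum>x\<in>UNIV. qchar x * of_bool (tr (x * w + r\<^sup>2 / x) = 0))" for r
  define B where "B r = (\<Sum>x\<in>UNIV. qchar x * of_bool (tr (x * w + (emb nonsq * r\<^sup>2) / x) = 0))" for r
  have swap: "(\<Sum>x\<in>UNIV. qchar x * (\<Sum>r\<in>UNIV. conic_sign r * f x r)) =
      (\<Sum>r\<in>UNIV. conic_sign r * (\<Sum>x\<in>UNIV. qchar x * f x r))" for f :: "'a cubic_ext \<Rightarrow> _ \<Rightarrow> int"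
    unfolding sum_distrib_left by (subst sum.swap) (simp add: mult.left_commute)
  have "2 * (\<Sum>x\<in>UNIV. \<Sum>z\<in>UNIV. qchar x * (tr0_sign z * of_bool (tr (x * w + z / x) = 0))) =
      (\<Sum>x\<in>UNIV. qchar x * (2 * (\<Sum>z\<in>UNIV. tr0_sign z * of_bool (tr (x * w + z / x) = 0))))"
    by (simp only: sum_distrib_left mult.left_commute)
  also have "\<dots> = (\<Sum>x\<in>UNIV. qchar x * (\<Sum>r\<in>UNIV. conic_sign r * of_bool (tr (x * w + r\<^sup>2 / x) = 0))) +
      (\<Sum>x\<in>UNIV. qchar x * (\<Sum>r\<in>UNIV. conic_sign r * of_bool (tr (x * w + (emb nonsq * r\<^sup>2) / x) = 0)))"
    by (simp only: sum_tr0_sign[symmetric] distrib_left sum.distrib)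
  also have "\<dots> = (\<Sum>r\<in>UNIV. conic_sign r * (A r + B r))"
    unfolding swap A_def B_def by (simp only: distrib_left sum.distrib)
  finally have sum_AB: "2 * (\<Sum>x\<in>UNIV. \<Sum>z\<in>UNIV. qchar x * (tr0_sign z * of_bool (tr (x * w + z / x) = 0))) =
    (\<Sum>r\<in>UNIV. conic_sign r * (A r + B r))" .
  from square_classes[of w] obtain v where v: "w = v\<^sup>2 \<or> w = emb nonsq * v\<^sup>2" by blast
  have v0: "v \<noteq> 0" using v w(1) by auto
  have trv: "tr (v\<^sup>2) = 0" using v w(2) nonsq_nonzero by (auto simp: tr_scale)
  have sv: "tr0_sign w = conic_sign v"
    using v by (auto simp: tr0_sign_square tr0_sign_nonsquare)
  have AB: "A r + B r = 2 * ?q * qchar (2::'a) * qchar (tr (r * v))" if r: "r \<noteq> 0" for r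
  proof -
    have neg: "qchar (v\<^sup>2 * (emb nonsq * r\<^sup>2)) = - 1" "qchar (emb nonsq * v\<^sup>2 * r\<^sup>2) = - 1"
      using r v0 by (simp_all add: qchar_mult_E qchar_emb qchar_nonsq qchar_square)
    from v show ?thesis
    proof
      assume v: "w = v\<^sup>2"
      have "A r = 2 * ?q * qchar (2::'a) * qchar (tr (r * v))"
        unfolding A_def v by (rule sum_qchar_salie_tr[OF r v0])
      moreover have "B r = 0"
        unfolding B_def v by (rule sum_qchar_nonsquare_eq_0[OF two_E neg(1)])
      ultimately show ?thesis by simp
    next
      assume v: "w = emb nonsq * v\<^sup>2"
      have "A r = 0"
        unfolding A_def v by (rule sum_qchar_nonsquare_eq_0[OF two_E neg(2)])
      moreover have "B r = (\<Sum>x\<in>UNIV. qchar x * of_bool (tr (x * v\<^sup>2 + r\<^sup>2 / x) = 0))"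
      proof -
        \<comment> \<open>The common factor n lies in F and drops out of the condition that the
          trace be 0.\<close>
        have "x * (emb nonsq * v\<^sup>2) + (emb nonsq * r\<^sup>2) / x = emb nonsq * (x * v\<^sup>2 + r\<^sup>2 / x)" for x
          by (simp add: distrib_left mult.left_commute)
        then show ?thesis
          unfolding B_def v using nonsq_nonzero by (simp only: tr_scale mult_eq_0_iff) simp
      qed
      ultimately show ?thesis
        by (simp only: sum_qchar_salie_tr[OF r v0] add_0_left)
    qed
  qed
  have "(\<Sum>r\<in>UNIV. conic_sign r * (A r + B r)) =
      (\<Sum>r\<in>UNIV. 2 * ?q * qchar (2::'a) * (conic_sign r * qchar (tr (r * v))))"
  proof (rule sum.cong[OF refl])
    fix r
    show "conic_sign r * (A r + B r) = 2 * ?q * qchar (2::'a) * (conic_sign r * qchar (tr (r * v)))"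
      using AB[of r] by (cases "r = 0") auto
  qed
  also have "\<dots> = 2 * ?q * qchar (2::'a) * ((?q\<^sup>2 - ?q) * (qchar (2::'a) * conic_sign v))"
    by (simp only: sum_conic_sign_tr[OF v0 trv] flip: sum_distrib_left)
  also have "\<dots> = 2 * ((?q ^ 3 - ?q\<^sup>2) * conic_sign v) * (qchar (2::'a) * qchar (2::'a))"
    by (simp add: power2_eq_square power3_eq_cube algebra_simps)
  also have "\<dots> = 2 * ((?q ^ 3 - ?q\<^sup>2) * conic_sign v)"
    by (simp add: two_F)
  finally show ?thesis
    unfolding sv using sum_AB by linarith
qed

section \<open>The sign on pairs as an eigenvector\<close>

definition pair_sign :: "'a cubic_ext \<Rightarrow> 'a cubic_ext \<Rightarrow> int" where
  "pair_sign x y = qchar x * tr0_sign (x * y)"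

lemma pair_sign_eq_0_iff: "pair_sign x y = 0 \<longleftrightarrow> x = 0 \<or> y = 0 \<or> tr (x * y) \<noteq> 0"
  by (auto simp: pair_sign_def tr0_sign_eq_0_iff)

lemma pair_sign_cases:
  "x \<noteq> 0 \<Longrightarrow> y \<noteq> 0 \<Longrightarrow> tr (x * y) = 0 \<Longrightarrow> pair_sign x y = 1 \<or> pair_sign x y = - 1"
  using qchar_cases[of x] tr0_sign_cases[of "x * y"] by (auto simp: pair_sign_def)

text \<open>The factor eta(c) arises twice, from eta(c x) and from the sign of c^2 x y, so the value
  belongs to the projective point.\<close>

lemma pair_sign_scale: "c \<noteq> 0 \<Longrightarrow> pair_sign (emb c * x) (emb c * y) = pair_sign x y"
proof -
  assume c: "c \<noteq> 0"
  have "emb c * x * (emb c * y) = (emb c)\<^sup>2 * (x * y)"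
    by (simp add: power2_eq_square mult_ac)
  then have "pair_sign (emb c * x) (emb c * y) = (qchar c * qchar x) * (qchar c * tr0_sign (x * y))"
    unfolding pair_sign_def by (simp only: tr0_sign_scale qchar_mult_E qchar_emb)
  then have "pair_sign (emb c * x) (emb c * y) = (qchar c * qchar c) * pair_sign x y"
    by (simp only: pair_sign_def mult_ac)
  with c show ?thesis by simp
qed

lemma pair_sign_swap:
  "pair_sign (emb nonsq * x) (y / emb nonsq) = - pair_sign x y"
  using nonsq_nonzero by (simp add: pair_sign_def qchar_mult_E qchar_emb qchar_nonsq)

text \<open>The trace condition is perpendicularity to (x0, y0) for the form tr(x y), and the factor
  is q - 1 times the eigenvalue q^2. The substitutions z = x y and x -> x0 x reduce the sum to the
  case w = x0 y0 above; if x0 or y0 is 0, only sums of eta over a trace-zero hyperplane remain, and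
  these are 0.\<close>

lemma sum_pair_sign:
  fixes x0 y0 :: "'a cubic_ext"
  assumes nz: "x0 \<noteq> 0 \<or> y0 \<noteq> 0" and tr0: "tr (x0 * y0) = 0"
  shows "(\<Sum>x\<in>UNIV. \<Sum>y\<in>UNIV. pair_sign x y * of_bool (tr (x0 * y + x * y0) = 0)) =
    ((int CARD('a)) ^ 3 - (int CARD('a))\<^sup>2) * pair_sign x0 y0"
proof -
  have "(\<Sum>y\<in>UNIV. pair_sign x y * of_bool (tr (x0 * y + x * y0) = 0)) =
      (\<Sum>z\<in>UNIV. qchar x * (tr0_sign z * of_bool (tr (x * y0 + x0 * z / x) = 0)))" for x
  proof (cases "x = 0")
    case False
    then show ?thesis
      by (intro sum.reindex_bij_witness[of _ "\<lambda>z. z / x" "\<lambda>y. x * y"])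
        (auto simp: pair_sign_def add.commute)
  qed (simp add: pair_sign_def)
  then have eq: "(\<Sum>x\<in>UNIV. \<Sum>y\<in>UNIV. pair_sign x y * of_bool (tr (x0 * y + x * y0) = 0)) =
      (\<Sum>x\<in>UNIV. \<Sum>z\<in>UNIV. qchar x * (tr0_sign z * of_bool (tr (x * y0 + x0 * z / x) = 0)))"
    (is "_ = ?S")
    by simp
  have swap: "?S = (\<Sum>z\<in>UNIV. tr0_sign z * (\<Sum>x\<in>UNIV. qchar x * of_bool (tr (x * y0 + x0 * z / x) = 0)))"
    unfolding sum_distrib_left by (subst sum.swap) (simp add: mult.left_commute)
  have H0: "(\<Sum>x\<in>UNIV. qchar x * of_bool (tr (k * x) = 0)) = 0" if k: "k \<noteq> 0" for k :: "'a cubic_ext"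
  proof -
    have "qchar k * (\<Sum>x\<in>UNIV. qchar x * of_bool (tr (k * x) = 0)) =
        (\<Sum>u\<in>(UNIV :: 'a cubic_ext set). qchar u * of_bool (tr u = 0))"
      unfolding sum_distrib_left
      by (rule sum.reindex_bij_witness[of _ "\<lambda>u. u / k" "\<lambda>x. k * x"])
        (use k in \<open>auto simp: qchar_mult_E\<close>)
    then show ?thesis using k sum_qchar_tr_eq[of 0] by simp
  qed
  consider "x0 = 0" "y0 \<noteq> 0" | "x0 \<noteq> 0" "y0 = 0" | "x0 \<noteq> 0" "y0 \<noteq> 0"
    using nz by blast
  then show ?thesis
  proof cases
    case 1
    then have "?S = 0"
      unfolding swap using H0[of y0] by (simp add: mult.commute)
    with 1 eq show ?thesis by (simp add: pair_sign_def)
  next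
    case 2
    \<comment> \<open>For y0 = 0 the variable x occurs only in the denominator; x -> 1/x preserves
      eta.\<close>
    have Z: "(\<Sum>x\<in>UNIV. qchar x * of_bool (tr (x0 * z / x) = 0)) = 0" if z: "z \<noteq> 0" for z
    proof -
      have inv: "qchar (1 / x) = qchar x" for x :: "'a cubic_ext"
        using qchar_mult_square[of x "1 / x"] by (cases "x = 0") (simp_all add: power2_eq_square)
      have "(\<Sum>x\<in>UNIV. qchar x * of_bool (tr (x0 * z / x) = 0)) =
          (\<Sum>x\<in>UNIV. qchar x * of_bool (tr ((x0 * z) * x) = 0))"
        by (rule sum.reindex_bij_witness[of _ "\<lambda>x. 1 / x" "\<lambda>x. 1 / x"]) (auto simp: inv)
      also have "\<dots> = 0"
        by (rule H0) (use 2 z in auto)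
      finally show ?thesis .
    qed
    have "tr0_sign z * (\<Sum>x\<in>UNIV. qchar x * of_bool (tr (x * 0 + x0 * z / x) = 0)) = 0" for z
      using Z[of z] tr0_sign_eq_0_iff[of 0] by (cases "z = 0") simp_all
    then have "?S = 0"
      unfolding swap unfolding 2(2) by (intro sum.neutral) blast
    with 2 eq tr0_sign_eq_0_iff[of 0] show ?thesis by (simp add: pair_sign_def)
  next
    case 3
    let ?f = "\<lambda>x. \<Sum>z\<in>UNIV. qchar x * (tr0_sign z * of_bool (tr (x * (x0 * y0) + z / x) = 0))"
    have "?S = (\<Sum>x\<in>UNIV. qchar x0 * ?f x)"
    proof (rule sum.reindex_bij_witness[of _ "\<lambda>x. x0 * x" "\<lambda>x. x / x0"], goal_cases)
      case (5 x)
      have "x / x0 * (x0 * y0) + z / (x / x0) = x * y0 + x0 * z / x" for z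
        using 3 by (simp add: mult.commute)
      moreover have "qchar x = qchar x0 * qchar (x / x0)"
        using qchar_mult_E[of x0 "x / x0"] 3 by simp
      ultimately show ?case
        unfolding sum_distrib_left by (simp only: mult.assoc)
    qed (use 3 in auto)
    also have "\<dots> = qchar x0 * (((int CARD('a)) ^ 3 - (int CARD('a))\<^sup>2) * tr0_sign (x0 * y0))"
      by (subst sum_distrib_left[symmetric], subst sum_tr0_sign_eigen) (use 3 tr0 in auto)
    finally show ?thesis
      unfolding eq unfolding pair_sign_def by (simp only: mult.left_commute)
  qed
qed

end

section \<open>Counting perpendicular pairs\<close>

lemma card_nonzero_Collect:
  fixes P :: "'b::{zero,finite} \<Rightarrow> bool"
  assumes "P 0"
  shows "int (card {x. x \<noteq> 0 \<and> P x}) = int (card {x. P x}) - 1"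
proof -
  have "{x. P x} = insert 0 {x. x \<noteq> 0 \<and> P x}" using assms by auto
  then show ?thesis by simp
qed

text \<open>This is the (q^2 - 1)-tightness of the complement of the two generators, counted on
  vectors. If x0 and y0 are nonzero, the count goes by x: for multiples x of x0 the two conditions
  on y coincide, for all other x they are independent.\<close>

lemma card_perp_pairs:
  fixes x0 y0 :: "'a::{field,finite} cubic_ext"
  assumes nz: "x0 \<noteq> 0 \<or> y0 \<noteq> 0" and tr0: "tr (x0 * y0) = 0"
  defines "q \<equiv> int CARD('a)"
  shows "int (card {(x, y). x \<noteq> 0 \<and> y \<noteq> 0 \<and> tr (x * y) = 0 \<and> tr (x0 * y + x * y0) = 0}) =
    (q - 1) * ((q\<^sup>2 - 1) * (q + 1) + q\<^sup>2 * of_bool (x0 \<noteq> 0 \<and> y0 \<noteq> 0))"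
    (is "int (card ?S) = _")
proof -
  have K: "int (card {y. y \<noteq> 0 \<and> tr (x * y) = 0}) = q\<^sup>2 - 1" if "x \<noteq> 0" for x :: "'a cubic_ext"
    using card_nonzero_Collect[of "\<lambda>y. tr (x * y) = 0"] card_tr_eq[OF that, of 0] by (simp add: q_def)
  consider "x0 \<noteq> 0" "y0 = 0" | "x0 = 0" "y0 \<noteq> 0" | "x0 \<noteq> 0" "y0 \<noteq> 0"
    using nz by blast
  then show ?thesis
  proof cases
    case 1
    have "?S = prod.swap ` (SIGMA y:{y. y \<noteq> 0 \<and> tr (x0 * y) = 0}. {x. x \<noteq> 0 \<and> tr (y * x) = 0})"
      using 1 by (auto simp: image_iff mult.commute)
    then have "int (card ?S) =
        (\<Sum>y | y \<noteq> 0 \<and> tr (x0 * y) = 0. int (card {x. x \<noteq> 0 \<and> tr (y * x) = 0}))"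
      by (simp add: card_image)
    also have "\<dots> = (\<Sum>y | y \<noteq> 0 \<and> tr (x0 * y) = 0. q\<^sup>2 - 1)"
      by (intro sum.cong refl K) simp
    also have "\<dots> = (q\<^sup>2 - 1) * (q\<^sup>2 - 1)"
      using K[OF 1(1)] by simp
    finally show ?thesis
      using 1 by (simp add: power2_eq_square algebra_simps)
  next
    case 2
    have "?S = (SIGMA x:{x. x \<noteq> 0 \<and> tr (y0 * x) = 0}. {y. y \<noteq> 0 \<and> tr (x * y) = 0})"
      using 2 by (auto simp: mult.commute)
    then have "int (card ?S) =
        (\<Sum>x | x \<noteq> 0 \<and> tr (y0 * x) = 0. int (card {y. y \<noteq> 0 \<and> tr (x * y) = 0}))"
      by simp
    also have "\<dots> = (\<Sum>x | x \<noteq> 0 \<and> tr (y0 * x) = 0. q\<^sup>2 - 1)"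
      by (intro sum.cong refl K) simp
    also have "\<dots> = (q\<^sup>2 - 1) * (q\<^sup>2 - 1)"
      using K[OF 2(2)] by simp
    finally show ?thesis
      using 2 by (simp add: power2_eq_square algebra_simps)
  next
    case 3
    define N where "N x = {y. y \<noteq> 0 \<and> tr (x * y) = 0 \<and> tr (x0 * y + x * y0) = 0}" for x
    define L where "L = range (\<lambda>c. emb c * x0)"
    have cL: "int (card L) = q"
      using 3 by (simp add: L_def q_def card_image inj_on_def)
    have L0: "0 \<in> L" unfolding L_def by (rule image_eqI[of _ _ 0]) auto
    have LN: "int (card (N x)) = q\<^sup>2 - 1" if "x \<in> L - {0}" for x
    proof -
      from that obtain c where c: "x = emb c * x0" "c \<noteq> 0" by (auto simp: L_def)
      have "N x = {y. y \<noteq> 0 \<and> tr (x0 * y) = 0}"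
        unfolding N_def c(1) tr_add mult.assoc tr_scale tr0 using c(2) by auto
      then show ?thesis using K[OF 3(1)] by simp
    qed
    \<comment> \<open>Two independent conditions leave q values of y; y = 0 is among them, and has
      to be removed, exactly if tr(y0 x) = 0.\<close>
    have NN: "int (card (N x)) = q - of_bool (tr (y0 * x) = 0)" if x: "x \<notin> L" for x
    proof -
      have x0': "x \<noteq> 0" using x L0 by auto
      have "x0 \<notin> range (\<lambda>c. emb c * x)"
      proof
        assume "x0 \<in> range (\<lambda>c. emb c * x)"
        then obtain c where c: "x0 = emb c * x" by auto
        then have "c \<noteq> 0" using 3 by auto
        then have "x = emb (inverse c) * x0" using c by simp
        then show False using x unfolding L_def by blast
      qed
      from card_tr_eq_two[OF x0' this, of "- tr (y0 * x)"]
      have c: "int (card {y. tr (x * y) = 0 \<and> tr (x0 * y) = - tr (y0 * x)}) = q"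
        by (simp add: q_def)
      have N: "N x = {y. y \<noteq> 0 \<and> (tr (x * y) = 0 \<and> tr (x0 * y) = - tr (y0 * x))}"
        by (auto simp: N_def tr_add mult.commute eq_neg_iff_add_eq_0)
      show ?thesis
      proof (cases "tr (y0 * x) = 0")
        case True
        then show ?thesis
          unfolding N using card_nonzero_Collect[of "\<lambda>y. tr (x * y) = 0 \<and> tr (x0 * y) = - tr (y0 * x)"] c
          by simp
      next
        case False
        then have "N x = {y. tr (x * y) = 0 \<and> tr (x0 * y) = - tr (y0 * x)}"
          unfolding N by auto
        then show ?thesis using c False by simp
      qed
    qed
    have "?S = (SIGMA x:UNIV - {0}. N x)"
      by (auto simp: N_def)
    then have "int (card ?S) = (\<Sum>x\<in>UNIV - {0}. int (card (N x)))"
      by simp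
    also have "UNIV - {0} = (L - {0}) \<union> (UNIV - L)"
      using L0 by auto
    also have "(\<Sum>x\<in>(L - {0}) \<union> (UNIV - L). int (card (N x))) =
        (\<Sum>x\<in>L - {0}. int (card (N x))) + (\<Sum>x\<in>UNIV - L. int (card (N x)))"
      by (rule sum.union_disjoint) auto
    also have "(\<Sum>x\<in>L - {0}. int (card (N x))) = (q - 1) * (q\<^sup>2 - 1)"
      using card.remove[OF _ L0] cL by (simp add: LN)
    also have "(\<Sum>x\<in>UNIV - L. int (card (N x))) = (\<Sum>x\<in>UNIV - L. q - of_bool (tr (y0 * x) = 0))"
      by (rule sum.cong) (auto simp: NN)
    also have "\<dots> = int (card (UNIV - L)) * q - int (card ((UNIV - L) \<inter> {x. tr (y0 * x) = 0}))"
      by (simp add: sum_subtractf)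
    also have "(UNIV - L) \<inter> {x. tr (y0 * x) = 0} = {x. tr (y0 * x) = 0} - L"
      by auto
    also have "int (card ({x. tr (y0 * x) = 0} - L)) = q\<^sup>2 - q"
    proof -
      have "L \<subseteq> {x. tr (y0 * x) = 0}"
        using tr0 by (auto simp: L_def mult.commute[of y0] mult.assoc tr_scale)
      then have "int (card ({x. tr (y0 * x) = 0} - L)) = int (card {x. tr (y0 * x) = 0}) - int (card L)"
        by (simp add: card_Diff_subset of_nat_diff card_mono)
      then show ?thesis
        using card_tr_eq[OF 3(2), of 0] cL by (simp add: q_def)
    qed
    also have "int (card (UNIV - L)) = q ^ 3 - q"
    proof -
      have "int (card (UNIV - L)) = int CARD('a cubic_ext) - int (card L)"
        by (simp add: card_Diff_subset of_nat_diff card_mono)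
      then show ?thesis using cL by (simp add: card_cubic_ext q_def)
    qed
    finally show ?thesis
      using 3 by (simp add: power2_eq_square power3_eq_cube algebra_simps)
  qed
qed

context field_card_1_mod_4
begin

text \<open>On pairs with nonzero sign, (1 + s sign)/2 is the indicator of the value s. Twice the
  count is therefore the plain count of perpendicular pairs plus s times the eigenvector
  sum.\<close>

lemma card_pair_sign_perp:
  fixes x0 y0 :: "'a cubic_ext"
  assumes nz: "x0 \<noteq> 0 \<or> y0 \<noteq> 0" and tr0: "tr (x0 * y0) = 0" and s: "s = 1 \<or> s = - 1"
  shows "card {(x, y). pair_sign x y = s \<and> tr (x0 * y + x * y0) = 0} =
    (CARD('a) - 1) * ((CARD('a)\<^sup>2 - 1) div 2 * (CARD('a) + 1) + CARD('a)\<^sup>2 * of_bool (pair_sign x0 y0 = s))"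
proof -
  define q where "q = int CARD('a)"
  let ?S = "{(x, y). x \<noteq> 0 \<and> y \<noteq> 0 \<and> tr (x * y) = 0 \<and> tr (x0 * y + x * y0) = 0}"
  let ?A = "{(x, y). pair_sign x y = s \<and> tr (x0 * y + x * y0) = 0}"
  have AS: "?A = ?S \<inter> {p. pair_sign (fst p) (snd p) = s}"
    using s by (auto simp: pair_sign_eq_0_iff) (metis pair_sign_eq_0_iff neg_equal_0_iff_equal one_neq_zero)+
  have "2 * int (card ?A) = (\<Sum>p\<in>?S. 2 * of_bool (pair_sign (fst p) (snd p) = s))"
    unfolding AS by (simp flip: sum_distrib_left)
  also have "\<dots> = (\<Sum>p\<in>?S. 1 + s * pair_sign (fst p) (snd p))"
    using s pair_sign_cases by (intro sum.cong) fastforce+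
  also have "\<dots> = int (card ?S) + s * (\<Sum>p\<in>?S. pair_sign (fst p) (snd p))"
    by (simp add: sum.distrib sum_distrib_left)
  also have "(\<Sum>p\<in>?S. pair_sign (fst p) (snd p)) =
      (\<Sum>p\<in>UNIV. pair_sign (fst p) (snd p) * of_bool (tr (x0 * snd p + fst p * y0) = 0))"
    by (rule sum.mono_neutral_cong_left) (auto simp: pair_sign_eq_0_iff)
  also have "\<dots> = (\<Sum>x\<in>UNIV. \<Sum>y\<in>UNIV. pair_sign x y * of_bool (tr (x0 * y + x * y0) = 0))"
    unfolding sum.cartesian_product by (simp only: UNIV_Times_UNIV case_prod_unfold)
  also have "\<dots> = (q ^ 3 - q\<^sup>2) * pair_sign x0 y0"
    unfolding q_def by (rule sum_pair_sign[OF nz tr0])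
  also have "int (card ?S) = (q - 1) * ((q\<^sup>2 - 1) * (q + 1) + q\<^sup>2 * of_bool (x0 \<noteq> 0 \<and> y0 \<noteq> 0))"
    unfolding q_def by (rule card_perp_pairs[OF nz tr0])
  finally have "2 * int (card ?A) = (q - 1) * ((q\<^sup>2 - 1) * (q + 1) +
      q\<^sup>2 * (of_bool (x0 \<noteq> 0 \<and> y0 \<noteq> 0) + s * pair_sign x0 y0))"
    by (simp add: power2_eq_square power3_eq_cube algebra_simps)
  also have "of_bool (x0 \<noteq> 0 \<and> y0 \<noteq> 0) + s * pair_sign x0 y0 = 2 * of_bool (pair_sign x0 y0 = s)"
    using s pair_sign_cases[of x0 y0] tr0 pair_sign_eq_0_iff[of x0 y0] by auto
  also have "q\<^sup>2 - 1 = 2 * int ((CARD('a)\<^sup>2 - 1) div 2)"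
  proof -
    \<comment> \<open>q is odd, so the truncating division by 2 is exact.\<close>
    have "odd CARD('a)" using q1 by presburger
    then have "even (CARD('a)\<^sup>2 - 1)" by simp
    then have "int (CARD('a)\<^sup>2 - 1) = 2 * int ((CARD('a)\<^sup>2 - 1) div 2)"
      by (metis dvd_mult_div_cancel of_nat_mult of_nat_numeral)
    then show ?thesis
      by (simp add: q_def of_nat_diff Suc_leI)
  qed
  also have "(q - 1) * (2 * int ((CARD('a)\<^sup>2 - 1) div 2) * (q + 1) + q\<^sup>2 * (2 * of_bool (pair_sign x0 y0 = s))) =
      2 * int ((CARD('a) - 1) * ((CARD('a)\<^sup>2 - 1) div 2 * (CARD('a) + 1) + CARD('a)\<^sup>2 * of_bool (pair_sign x0 y0 = s)))"
    by (simp only: of_nat_mult of_nat_add of_nat_of_bool of_nat_power q_def)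
      (simp add: of_nat_diff Suc_leI algebra_simps)
  finally show ?thesis by linarith
qed

end

section \<open>Hyperbolic coordinates\<close>

lemma polar_form_commute: "polar_form Q u v = polar_form Q v u"
  by (simp add: polar_form_def add.commute)

lemma quadratic_form_scale: "quadratic_form Q \<Longrightarrow> Q (c *s v) = c\<^sup>2 * Q v"
  by (simp add: quadratic_form_def)

lemma quadratic_form_add: "Q (u + v) = Q u + Q v + polar_form Q u v"
  by (simp add: polar_form_def)

lemma polar_form_add_left:
  "quadratic_form Q \<Longrightarrow> polar_form Q (u + u') v = polar_form Q u v + polar_form Q u' v"
  unfolding quadratic_form_def by (metis Vector_Spaces.linear.axioms(3) module_hom.add)

lemma polar_form_scale_left:
  "quadratic_form Q \<Longrightarrow> polar_form Q (c *s u) v = c * polar_form Q u v"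
  unfolding quadratic_form_def by (metis Vector_Spaces.linear.axioms(3) module_hom.scale)

lemma polar_form_add_right:
  "quadratic_form Q \<Longrightarrow> polar_form Q v (u + u') = polar_form Q v u + polar_form Q v u'"
  by (simp add: polar_form_commute[of Q v] polar_form_add_left)

lemma polar_form_scale_right:
  "quadratic_form Q \<Longrightarrow> polar_form Q v (c *s u) = c * polar_form Q v u"
  by (simp add: polar_form_commute[of Q v] polar_form_scale_left)

lemma polar_form_0_left: "quadratic_form Q \<Longrightarrow> polar_form Q 0 v = 0"
  using polar_form_scale_left[of Q 0 0 v] by simp

lemma polar_form_sum_left:
  "quadratic_form Q \<Longrightarrow> polar_form Q (\<Sum>i\<in>A. c i *s u i) v = (\<Sum>i\<in>A. c i * polar_form Q (u i) v)"
  by (induction A rule: infinite_finite_induct)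
    (auto simp: polar_form_add_left polar_form_scale_left polar_form_0_left)

lemma polar_form_sum_right:
  "quadratic_form Q \<Longrightarrow> polar_form Q v (\<Sum>i\<in>A. c i *s u i) = (\<Sum>i\<in>A. c i * polar_form Q v (u i))"
  by (simp add: polar_form_commute[of Q v] polar_form_sum_left)

lemma polar_form_self:
  assumes "quadratic_form Q"
  shows "polar_form Q v v = 2 * Q v"
proof -
  have "v + v = 2 *s v" by (simp add: vec_eq_iff)
  then show ?thesis
    using quadratic_form_scale[OF assms, of 2 v] by (simp add: polar_form_def)
qed

lemma polar_form_diff_left:
  assumes "quadratic_form Q"
  shows "polar_form Q (u - u') v = polar_form Q u v - polar_form Q u' v"
  using polar_form_add_left[OF assms, of "u - u'" u' v] by simp

text \<open>A vector \<open>u i\<close> in the span of the others would be orthogonal to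
  \<open>w i\<close>, as the others are.\<close>

lemma independent_if_dual:
  fixes u w :: "'i::finite \<Rightarrow> 'a::field ^ 'n"
  assumes Q: "quadratic_form Q" and dual: "\<And>i j. polar_form Q (u i) (w j) = (if i = j then 1 else 0)"
  shows "vec.independent (range u)" "inj u"
proof -
  show "inj u"
    by (rule injI) (metis dual zero_neq_one)
  show "vec.independent (range u)"
  proof
    assume "vec.dependent (range u)"
    then obtain i where i: "u i \<in> vec.span (range u - {u i})"
      unfolding vec.dependent_def by blast
    have "vec.subspace {v. polar_form Q v (w i) = 0}"
      by (auto simp: vec.subspace_def polar_form_add_left[OF Q] polar_form_scale_left[OF Q]
          polar_form_0_left[OF Q])
    moreover have "range u - {u i} \<subseteq> {v. polar_form Q v (w i) = 0}"
      using dual by auto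
    ultimately have "vec.span (range u - {u i}) \<subseteq> {v. polar_form Q v (w i) = 0}"
      by (intro vec.span_minimal)
    with i have "polar_form Q (u i) (w i) = 0" by blast
    then show False by (simp add: dual)
  qed
qed

text \<open>A totally singular 3-space U supplies the vectors \<open>u i\<close>. Nondegeneracy
  makes their polar functionals independent, so dual vectors \<open>w0 j\<close> exist; subtracting
  elements of U makes these pairwise orthogonal without disturbing the duality.\<close>

lemma hyperbolic_form5_dual_frames:
  fixes Q :: "'a::{field,finite} ^ 6 \<Rightarrow> 'a"
  assumes two: "(2::'a) \<noteq> 0" and hyp: "hyperbolic_form5 Q"
  shows "\<exists>u w :: 3 \<Rightarrow> 'a ^ 6.
    (\<forall>i j. polar_form Q (u i) (w j) = (if i = j then 1 else 0)) \<and>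
    (\<forall>i j. polar_form Q (u i) (u j) = 0) \<and> (\<forall>i j. polar_form Q (w i) (w j) = 0)"
proof -
  have Q: "quadratic_form Q" and nondeg: "nondegenerate_form Q" and witt: "witt_index Q = 3"
    using hyp by (auto simp: hyperbolic_form5_def)
  let ?D = "{vec.dim U | U. totally_singular Q U}"
  \<comment> \<open>\<open>Max\<close> is attained only on a finite nonempty set: dimensions are at
    most 6, and {0} is totally singular.\<close>
  have "?D \<subseteq> {..6}"
    using vec.dim_subset_UNIV[where 'a='a and 'b=6] by (auto simp: vec.dimension_def card_cart_basis)
  then have "finite ?D" by (rule finite_subset) simp
  moreover have "totally_singular Q {0}"
    using quadratic_form_scale[OF Q, of 0 0] by (simp add: totally_singular_def)
  then have "?D \<noteq> {}" by blast
  ultimately have "Max ?D \<in> ?D" by (rule Max_in)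
  then obtain U where U: "totally_singular Q U" "vec.dim U = 3"
    using witt unfolding witt_index_def by auto
  have subU: "vec.subspace U" and sing: "\<And>v. v \<in> U \<Longrightarrow> Q v = 0"
    using U by (auto simp: totally_singular_def)
  obtain b where b: "b \<subseteq> U" "vec.independent b" "U \<subseteq> vec.span b" "card b = vec.dim U"
    by (rule vec.basis_exists)
  have "finite b" by simp
  then obtain u :: "3 \<Rightarrow> 'a ^ 6" where u: "bij_betw u UNIV b"
    using finite_same_card_bij[of "UNIV :: 3 set" b] b(4) U(2) by auto
  have uU: "u i \<in> U" for i
    using u b(1) by (auto simp: bij_betw_def)
  have indep: "c i = 0" if "(\<Sum>i\<in>UNIV. c i *s u i) = 0" for c and i :: 3
  proof -
    have "(\<Sum>v\<in>b. c (inv_into UNIV u v) *s v) = (\<Sum>i\<in>UNIV. c i *s u i)"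
      using u by (intro sum.reindex_bij_betw[OF u, symmetric, THEN trans] sum.cong)
        (auto simp: bij_betw_def)
    with that have "(\<Sum>v\<in>b. c (inv_into UNIV u v) *s v) = 0" by simp
    from vec.independentD[OF b(2) \<open>finite b\<close> subset_refl this, of "u i"]
    show ?thesis using u by (auto simp: bij_betw_def)
  qed
  define A :: "'a ^ 6 ^ 3" where "A = (\<chi> i j. polar_form Q (u i) (axis j 1))"
  have A: "(A *v v) $ i = polar_form Q (u i) v" for v i
  proof -
    have "polar_form Q (u i) v = polar_form Q (u i) (\<Sum>j\<in>UNIV. (v $ j) *s axis j 1)"
      by (simp only: basis_expansion)
    also have "\<dots> = (A *v v) $ i"
      by (simp add: polar_form_sum_right[OF Q] A_def matrix_vector_mult_def mult.commute)
    finally show ?thesis by simp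
  qed
  \<comment> \<open>A relation among the rows is a vector of U orthogonal to the whole space; being
    singular, it is 0 by nondegeneracy.\<close>
  have "\<exists>B :: 'a ^ 3 ^ 6. A ** B = mat 1"
    unfolding matrix_right_invertible_independent_rows
  proof (intro allI impI)
    fix c and i :: 3
    assume c: "(\<Sum>i\<in>UNIV. c i *s row i A) = 0"
    let ?x = "\<Sum>i\<in>UNIV. c i *s u i"
    have "polar_form Q ?x (axis j 1) = 0" for j
      using arg_cong[OF c, of "\<lambda>v. v $ j"] by (simp add: polar_form_sum_left[OF Q] A_def row_def)
    then have "polar_form Q ?x v = 0" for v
      using polar_form_sum_right[OF Q, of ?x "\<lambda>j. v $ j" "\<lambda>j. axis j 1" UNIV]
      by (simp add: basis_expansion)
    moreover have "?x \<in> U"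
      by (intro vec.subspace_sum[OF subU] vec.subspace_scale[OF subU] uU)
    then have "Q ?x = 0" by (rule sing)
    ultimately have "?x = 0"
      using nondeg unfolding nondegenerate_form_def by blast
    then show "c i = 0" by (rule indep)
  qed
  then obtain B :: "'a ^ 3 ^ 6" where B: "A ** B = mat 1" ..
  define w0 where "w0 j = column j B" for j
  have uw0: "polar_form Q (u i) (w0 j) = (if i = j then 1 else 0)" for i j
  proof -
    have "polar_form Q (u i) (w0 j) = (A ** B) $ i $ j"
      unfolding A[symmetric] w0_def by (simp add: matrix_vector_mult_def matrix_matrix_mult_def column_def)
    then show ?thesis by (simp add: B mat_def)
  qed
  have uu: "polar_form Q (u i) (u j) = 0" for i j
    using sing[OF uU] sing[OF vec.subspace_add[OF subU uU uU]] by (simp add: polar_form_def)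
  \<comment> \<open>The corrections of \<open>w0 i\<close> and of \<open>w0 j\<close> each remove
    half of their polar value; here 2 must be invertible.\<close>
  define w where "w j = w0 j - (\<Sum>k\<in>UNIV. (polar_form Q (w0 j) (w0 k) / 2) *s u k)" for j
  have uw: "polar_form Q (u i) (w j) = (if i = j then 1 else 0)" for i j
    unfolding w_def polar_form_commute[of Q "u i"] polar_form_diff_left[OF Q] polar_form_sum_left[OF Q]
    by (simp add: uu uw0 polar_form_commute[of Q "w0 j"])
  have delta: "(\<Sum>k\<in>UNIV. g k * (if k = j then 1 else 0)) = g j" for g :: "3 \<Rightarrow> 'a" and j
    by (simp add: if_distrib[of "\<lambda>t. _ * t"] cong: if_cong)
  have ww0: "polar_form Q (w i) (w0 j) = polar_form Q (w0 i) (w0 j) / 2" for i j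
    unfolding w_def polar_form_diff_left[OF Q] polar_form_sum_left[OF Q] uw0 delta
    using two by (simp add: field_simps)
  have ww: "polar_form Q (w i) (w j) = 0" for i j
  proof -
    have "polar_form Q (w i) (w j) = polar_form Q (w j) (w i)" by (rule polar_form_commute)
    also have "\<dots> = polar_form Q (w0 j) (w i) - polar_form Q (w0 j) (w0 i) / 2"
      by (subst w_def[of j]) (simp only: polar_form_diff_left[OF Q] polar_form_sum_left[OF Q] uw delta)
    also have "\<dots> = 0"
      by (simp add: polar_form_commute[of Q "w0 j"] ww0)
    finally show ?thesis .
  qed
  show ?thesis using uw uu ww by blast
qed

text \<open>Coordinates of x along e and of y along the dual basis f satisfy tr(x y) = sum of tr(x
  f_i) tr(e_i y), which is the hyperbolic form in the frames u, w. Bijectivity follows from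
  injectivity, as both sides have q^6 elements.\<close>

lemma hyperbolic_form5_coordinates:
  fixes Q :: "'a::{field,finite} ^ 6 \<Rightarrow> 'a"
  assumes two: "(2::'a) \<noteq> 0" and hyp: "hyperbolic_form5 Q"
  shows "\<exists>\<Psi> :: 'a cubic_ext \<Rightarrow> 'a cubic_ext \<Rightarrow> 'a ^ 6.
    bij (\<lambda>p. \<Psi> (fst p) (snd p)) \<and>
    (\<forall>x y x' y'. \<Psi> (x + x') (y + y') = \<Psi> x y + \<Psi> x' y') \<and>
    (\<forall>c x y. \<Psi> (emb c * x) (emb c * y) = c *s \<Psi> x y) \<and>
    (\<forall>x y. Q (\<Psi> x y) = tr (x * y)) \<and>
    vec.dim (range (\<lambda>x. \<Psi> x 0)) = 3 \<and> vec.dim (range (\<lambda>y. \<Psi> 0 y)) = 3"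
proof -
  have Q: "quadratic_form Q" using hyp by (simp add: hyperbolic_form5_def)
  obtain u w :: "3 \<Rightarrow> 'a ^ 6" where
    uw: "\<And>i j. polar_form Q (u i) (w j) = (if i = j then 1 else 0)" and
    uu: "\<And>i j. polar_form Q (u i) (u j) = 0" and ww: "\<And>i j. polar_form Q (w i) (w j) = 0"
    using hyperbolic_form5_dual_frames[OF assms] by blast
  have wu: "polar_form Q (w i) (u j) = (if i = j then 1 else 0)" for i j
    using uw[of j i] by (simp add: polar_form_commute[of Q "w i"])
  obtain e f :: "3 \<Rightarrow> 'a cubic_ext" where ef: "\<And>i j. tr (e i * f j) = (if j = i then 1 else 0)" and
    dual: "\<And>x. x = (\<Sum>i\<in>UNIV. emb (tr (x * f i)) * e i)"
    using ex_tr_dual_bases by metis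
  define Xu where "Xu x = (\<Sum>i\<in>UNIV. tr (x * f i) *s u i)" for x
  define Yw where "Yw y = (\<Sum>i\<in>UNIV. tr (e i * y) *s w i)" for y
  define \<Psi> where "\<Psi> x y = Xu x + Yw y" for x y
  have tr_mult: "tr (x * y) = (\<Sum>i\<in>UNIV. tr (x * f i) * tr (e i * y))" for x y
    by (subst dual[of x]) (simp only: sum_distrib_right tr_sum mult.assoc tr_scale)
  have X_add: "Xu (x + x') = Xu x + Xu x'" and Y_add: "Yw (x + x') = Yw x + Yw x'" for x x'
    by (simp_all add: Xu_def Yw_def distrib_left distrib_right tr_add vec.scale_left_distrib sum.distrib)
  have X_scale: "Xu (emb c * x) = c *s Xu x" and Y_scale: "Yw (emb c * x) = c *s Yw x" for c x
    by (simp_all add: Xu_def Yw_def mult.assoc tr_scale tr_scale_right vec.scale_sum_right)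
  have add: "\<Psi> (x + x') (y + y') = \<Psi> x y + \<Psi> x' y'" for x y x' y'
    by (simp add: \<Psi>_def X_add Y_add)
  have scale: "\<Psi> (emb c * x) (emb c * y) = c *s \<Psi> x y" for c x y
    by (simp add: \<Psi>_def X_scale Y_scale vec.scale_right_distrib)
  have XX: "Q (Xu x) = 0" for x
  proof -
    have "polar_form Q (Xu x) (Xu x) = 0"
      by (simp add: Xu_def polar_form_sum_left[OF Q] polar_form_sum_right[OF Q] uu)
    then show ?thesis using two by (simp add: polar_form_self[OF Q])
  qed
  have YY: "Q (Yw x) = 0" for x
  proof -
    have "polar_form Q (Yw x) (Yw x) = 0"
      by (simp add: Yw_def polar_form_sum_left[OF Q] polar_form_sum_right[OF Q] ww)
    then show ?thesis using two by (simp add: polar_form_self[OF Q])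
  qed
  have uY: "polar_form Q (u i) (Yw y) = tr (e i * y)" for i y
    by (simp add: Yw_def polar_form_sum_right[OF Q] uw if_distrib[of "\<lambda>t. _ * t"] cong: if_cong)
  have wX: "polar_form Q (w i) (Xu x) = tr (x * f i)" for i x
    by (simp add: Xu_def polar_form_sum_right[OF Q] wu if_distrib[of "\<lambda>t. _ * t"] cong: if_cong)
  have uX: "polar_form Q (u i) (Xu x) = 0" and wY: "polar_form Q (w i) (Yw x) = 0" for i x
    by (simp_all add: Xu_def Yw_def polar_form_sum_right[OF Q] uu ww)
  have "polar_form Q (Xu x) (Yw y) = tr (x * y)" for x y
    using tr_mult[of x y] by (simp add: Xu_def polar_form_sum_left[OF Q] uY)
  then have Q\<Psi>: "Q (\<Psi> x y) = tr (x * y)" for x y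
    by (simp add: \<Psi>_def quadratic_form_add XX YY)
  have ker: "x = 0 \<and> y = 0" if "\<Psi> x y = 0" for x y
  proof -
    \<comment> \<open>Pairing with u sees only y and pairing with w only x, so both can be recovered
      from the vector.\<close>
    have u0: "polar_form Q (u i) (\<Psi> x y) = 0" and w0: "polar_form Q (w i) (\<Psi> x y) = 0" for i
      unfolding that using polar_form_0_left[OF Q] by (simp_all add: polar_form_commute[of Q _ 0])
    have "tr (e i * y) = 0" for i
      using u0[of i] by (simp add: \<Psi>_def polar_form_add_right[OF Q] uX uY)
    then have "tr (y * x') = 0" for x'
      using tr_mult[of x' y] by (simp add: mult.commute)
    then have "y = 0" using ex_tr_mult_nonzero by blast
    moreover have "tr (x * f i) = 0" for i
      using w0[of i] by (simp add: \<Psi>_def polar_form_add_right[OF Q] wX wY)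
    then have "x = 0" using dual[of x] by simp
    ultimately show ?thesis by simp
  qed
  have "inj (\<lambda>p. \<Psi> (fst p) (snd p))"
  proof (rule injI)
    fix p p' assume "\<Psi> (fst p) (snd p) = \<Psi> (fst p') (snd p')"
    then have "\<Psi> (fst p - fst p') (snd p - snd p') = 0"
      using add[of "fst p - fst p'" "fst p'" "snd p - snd p'" "snd p'"] by simp
    from ker[OF this] show "p = p'" by (simp add: prod_eq_iff)
  qed
  moreover have "CARD('a cubic_ext \<times> 'a cubic_ext) = CARD('a ^ 6)"
    by (simp add: card_cubic_ext card_cartesian_product flip: power_add UNIV_Times_UNIV)
  ultimately have bij: "bij (\<lambda>p. \<Psi> (fst p) (snd p))"
    unfolding bij_def by (metis card_image card_subset_eq finite subset_UNIV)
  have Y0: "Yw 0 = 0" and X0: "Xu 0 = 0"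
    by (simp_all add: Xu_def Yw_def)
  have "range (\<lambda>x. \<Psi> x 0) = vec.span (range u)"
  proof (rule antisym)
    show "range (\<lambda>x. \<Psi> x 0) \<subseteq> vec.span (range u)"
      by (auto simp: \<Psi>_def Y0 Xu_def intro: vec.span_sum vec.span_scale vec.span_base)
    have "vec.subspace (range (\<lambda>x. \<Psi> x 0))"
      unfolding vec.subspace_def \<Psi>_def Y0 by (auto simp flip: X_add X_scale X0)
    moreover have "u j = \<Psi> (e j) 0" for j
      by (simp add: \<Psi>_def Y0 Xu_def ef if_distrib[of "\<lambda>t. t *s _"] cong: if_cong)
    then have "range u \<subseteq> range (\<lambda>x. \<Psi> x 0)" by blast
    ultimately show "vec.span (range u) \<subseteq> range (\<lambda>x. \<Psi> x 0)"
      by (intro vec.span_minimal)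
  qed
  moreover have "vec.dim (vec.span (range u)) = 3"
    using independent_if_dual[OF Q uw]
    by (simp add: vec.dim_eq_card_independent card_image)
  moreover have "range (\<lambda>y. \<Psi> 0 y) = vec.span (range w)"
  proof (rule antisym)
    show "range (\<lambda>y. \<Psi> 0 y) \<subseteq> vec.span (range w)"
      by (auto simp: \<Psi>_def X0 Yw_def intro: vec.span_sum vec.span_scale vec.span_base)
    have "vec.subspace (range (\<lambda>y. \<Psi> 0 y))"
      unfolding vec.subspace_def \<Psi>_def X0 by (auto simp flip: Y_add Y_scale Y0)
    moreover have "w j = \<Psi> 0 (f j)" for j
      by (simp add: \<Psi>_def X0 Yw_def ef if_distrib[of "\<lambda>t. t *s _"] cong: if_cong)
    then have "range w \<subseteq> range (\<lambda>y. \<Psi> 0 y)" by blast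
    ultimately show "vec.span (range w) \<subseteq> range (\<lambda>y. \<Psi> 0 y)"
      by (intro vec.span_minimal)
  qed
  moreover have "vec.dim (vec.span (range w)) = 3"
    using independent_if_dual[OF Q wu]
    by (simp add: vec.dim_eq_card_independent card_image)
  ultimately show ?thesis
    using bij add scale Q\<Psi> by (intro exI[of _ \<Psi>]) simp
qed

section \<open>Points, perpendicularity and collineations\<close>

lemma span_singleton_pg_point: "v \<noteq> 0 \<Longrightarrow> vec.span {v} \<in> pg_points"
  by (simp add: pg_points_def vec.dim_eq_card_independent)

lemma pg_point_eq_range:
  assumes "P \<in> pg_points" "v \<in> P" "v \<noteq> 0"
  shows "P = range (\<lambda>c. c *s v)"
proof -
  have P: "vec.subspace P" "vec.dim P = 1" using assms by (auto simp: pg_points_def)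
  have sub: "vec.span {v} \<subseteq> P"
    using assms P by (intro vec.span_minimal) auto
  have "vec.span {v} = P"
    by (rule vec.subspace_dim_equal) (use P sub assms(3) in \<open>auto simp: vec.dim_eq_card_independent\<close>)
  then show ?thesis by (simp add: vec.span_singleton)
qed

lemma pg_point_nonzero:
  assumes "P \<in> pg_points"
  obtains v where "v \<in> P" "v \<noteq> 0"
proof -
  have "P \<noteq> {0}" using assms by (auto simp: pg_points_def)
  moreover have "0 \<in> P" using assms by (auto simp: pg_points_def vec.subspace_0)
  ultimately show ?thesis using that by auto
qed

text \<open>S is partitioned into punctured points with q - 1 vectors each; this converts vector
  counts into point counts.\<close>

lemma card_pg_points_of_cone:
  fixes S :: "('a::{field,finite} ^ 'n) set"
  assumes S0: "0 \<notin> S" and scale: "\<And>c v. c \<noteq> 0 \<Longrightarrow> v \<in> S \<Longrightarrow> c *s v \<in> S"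
  shows "card S = (CARD('a) - 1) * card {P \<in> pg_points. P - {0} \<subseteq> S}"
proof -
  let ?T = "{P \<in> pg_points. P - {0} \<subseteq> S}"
  have "S = (\<Union>P\<in>?T. P - {0})"
  proof (rule antisym)
    show "S \<subseteq> (\<Union>P\<in>?T. P - {0})"
    proof
      fix v assume v: "v \<in> S"
      then have "v \<noteq> 0" using S0 by auto
      moreover have "vec.span {v} - {0} \<subseteq> S"
      proof
        fix z assume "z \<in> vec.span {v} - {0}"
        then obtain c where "z = c *s v" "c \<noteq> 0" by (auto simp: vec.span_singleton)
        then show "z \<in> S" using scale v by simp
      qed
      ultimately have "vec.span {v} \<in> ?T" "v \<noteq> 0"
        by (simp_all add: span_singleton_pg_point)
      then show "v \<in> (\<Union>P\<in>?T. P - {0})"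
        by (auto intro!: bexI[of _ "vec.span {v}"] vec.span_base)
    qed
  qed auto
  moreover have "card (\<Union>P\<in>?T. P - {0}) = (\<Sum>P\<in>?T. card (P - {0}))"
  proof (rule card_UN_disjoint)
    show "\<forall>P\<in>?T. \<forall>R\<in>?T. P \<noteq> R \<longrightarrow> (P - {0}) \<inter> (R - {0}) = {}"
    proof (intro ballI impI)
      fix P R assume PR: "P \<in> ?T" "R \<in> ?T" "P \<noteq> R"
      have False if "v \<in> P" "v \<in> R" "v \<noteq> 0" for v
        using pg_point_eq_range[of P v] pg_point_eq_range[of R v] that PR by simp
      then show "(P - {0}) \<inter> (R - {0}) = {}" by auto
    qed
  qed auto
  moreover have "card (P - {0}) = CARD('a) - 1" if "P \<in> ?T" for P
  proof -
    from that obtain v where v: "v \<in> P" "v \<noteq> 0" using pg_point_nonzero by blast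
    then have P: "P = range (\<lambda>c. c *s v)" using pg_point_eq_range[of P v] that by simp
    then have "0 \<in> P" by (metis rangeI vec.scale_zero_left)
    moreover have "inj (\<lambda>c. c *s v)" using v by (auto simp: inj_on_def)
    ultimately show ?thesis unfolding P by (simp add: card_Diff_singleton card_image)
  qed
  ultimately show ?thesis by simp
qed

lemma quadric_iff:
  assumes Q: "quadratic_form Q" and P: "P \<in> pg_points" "v \<in> P" "v \<noteq> 0"
  shows "P \<in> quadric Q \<longleftrightarrow> Q v = 0"
  using P pg_point_eq_range[OF P] by (auto simp: quadric_def quadratic_form_scale[OF Q])

text \<open>A line of the quadric through both points contains the span of v + w, so v, w and v + w
  are all singular and the polar form vanishes. Conversely, orthogonal singular vectors of distinct
  points span a totally singular 2-space.\<close>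

lemma quadric_perp_iff:
  assumes Q: "quadratic_form Q"
    and P: "P \<in> quadric Q" "v \<in> P" "v \<noteq> 0" and R: "R \<in> quadric Q" "w \<in> R" "w \<noteq> 0"
  shows "R \<in> quadric_perp Q P \<longleftrightarrow> polar_form Q v w = 0"
proof -
  have P': "P \<in> pg_points" and R': "R \<in> pg_points" and Qv: "Q v = 0" and Qw: "Q w = 0"
    using P R by (auto simp: quadric_def)
  note Pv = pg_point_eq_range[OF P' P(2,3)] and Rw = pg_point_eq_range[OF R' R(2,3)]
  show ?thesis
  proof
    assume "R \<in> quadric_perp Q P"
    then consider "R = P" | L where "L \<in> pg_lines" "L \<subseteq> quadric Q" "P \<in> L" "R \<in> L"
      by (auto simp: quadric_perp_def)
    then show "polar_form Q v w = 0"
    proof cases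
      case 1
      then obtain c where "w = c *s v" using R(2) Pv by auto
      then show ?thesis
        by (simp add: polar_form_scale_right[OF Q] polar_form_self[OF Q] Qv)
    next
      case 2
      then obtain U where U: "vec.subspace U" "L = {P \<in> pg_points. P \<subseteq> U}"
        by (auto simp: pg_subspaces_def)
      have "v + w \<in> U"
        using 2 U P(2) R(2) by (intro vec.subspace_add[OF U(1)]) auto
      \<comment> \<open>For w = - v the sum spans no point and is treated apart.\<close>
      have "Q (v + w) = 0"
      proof (cases "v + w = 0")
        case True
        then show ?thesis using quadratic_form_scale[OF Q, of 0 0] by simp
      next
        case False
        have "vec.span {v + w} \<subseteq> U"
          using \<open>v + w \<in> U\<close> U(1) by (intro vec.span_minimal) auto
        then have "vec.span {v + w} \<in> quadric Q"
          using 2(2) U(2) span_singleton_pg_point[OF False] by auto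
        then show ?thesis
          by (auto simp: quadric_def intro: vec.span_base)
      qed
      then show ?thesis by (simp add: polar_form_def Qv Qw)
    qed
  next
    assume vw: "polar_form Q v w = 0"
    show "R \<in> quadric_perp Q P"
    proof (cases "R = P")
      case False
      define U where "U = vec.span {v, w}"
      have "w \<notin> vec.span {v}"
        using False Pv Rw pg_point_eq_range[OF P' _ R(3)] by (auto simp: vec.span_singleton)
      then have "vec.independent {w, v}"
        using P(3) by (simp add: vec.independent_insert)
      moreover have "v \<noteq> w" using \<open>w \<notin> vec.span {v}\<close> by (auto intro: vec.span_base)
      ultimately have dim: "vec.dim U = 2"
        unfolding U_def by (simp add: vec.dim_eq_card_independent insert_commute)
      define L where "L = {P \<in> pg_points. P \<subseteq> U}"
      have "L \<in> pg_lines"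
        unfolding pg_subspaces_def L_def using dim by (auto simp: U_def)
      moreover have "L \<subseteq> quadric Q"
      proof -
        have "Q z = 0" if "z \<in> U" for z
        proof -
          from that obtain a b where "z - a *s v = b *s w"
            unfolding U_def by (auto simp: vec.span_insert vec.span_singleton)
          then have "z = a *s v + b *s w" by (metis add.commute diff_add_cancel)
          then show ?thesis
            by (simp add: quadratic_form_add quadratic_form_scale[OF Q] Qv Qw
                polar_form_scale_left[OF Q] polar_form_scale_right[OF Q] vw)
        qed
        then show ?thesis by (auto simp: L_def quadric_def)
      qed
      moreover have "P \<subseteq> U" "R \<subseteq> U"
        unfolding Pv Rw U_def by (auto intro!: vec.span_scale intro: vec.span_base)
      then have "P \<in> L" "R \<in> L"
        using P' R' by (simp_all add: L_def)
      ultimately show ?thesis by (auto simp: quadric_perp_def)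
    qed (simp add: quadric_perp_def)
  qed
qed

text \<open>The linear inverse gives the dimension inequality in both directions and shows that
  every line is an image.\<close>

lemma pg_collineation_of_linear:
  fixes g g' :: "'a::field ^ 'n \<Rightarrow> 'a ^ 'n"
  assumes lin: "Vector_Spaces.linear (*s) (*s) g" "Vector_Spaces.linear (*s) (*s) g'"
    and inv: "\<And>v. g' (g v) = v" "\<And>v. g (g' v) = v"
  shows "pg_collineation ((`) g)"
proof -
  have dim: "vec.dim (g ` U) = vec.dim U"
    if "Vector_Spaces.linear (*s) (*s) g" "Vector_Spaces.linear (*s) (*s) g'" "\<And>v. g' (g v) = v"
    for g g' :: "'a ^ 'n \<Rightarrow> 'a ^ 'n" and U
  proof (rule antisym)
    show "vec.dim (g ` U) \<le> vec.dim U"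
      by (rule vec.dim_image_le[OF that(1)])
    have "vec.dim (g' ` g ` U) \<le> vec.dim (g ` U)"
      by (rule vec.dim_image_le[OF that(2)])
    then show "vec.dim U \<le> vec.dim (g ` U)"
      by (simp add: image_image that(3))
  qed
  have pt: "g ` P \<in> pg_points" if "P \<in> pg_points" for P
    using that vec.linear_subspace_image[OF lin(1)] dim[OF lin inv(1)]
    by (auto simp: pg_points_def)
  have pt': "g' ` P \<in> pg_points" if "P \<in> pg_points" for P
    using that vec.linear_subspace_image[OF lin(2)] dim[OF lin(2,1) inv(2)]
    by (auto simp: pg_points_def)
  have gg': "g ` g' ` A = A" and g'g: "g' ` g ` A = A" for A
    by (simp_all add: image_image inv)
  have "bij_betw ((`) g) pg_points pg_points"
    by (rule bij_betw_byWitness[where f' = "(`) g'"]) (auto simp: gg' g'g intro: pt pt')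
  moreover have line: "((`) g) ` {P \<in> pg_points. P \<subseteq> U} = {P \<in> pg_points. P \<subseteq> g ` U}" for U
  proof (rule antisym)
    show "{P \<in> pg_points. P \<subseteq> g ` U} \<subseteq> ((`) g) ` {P \<in> pg_points. P \<subseteq> U}"
    proof
      fix P assume P: "P \<in> {P \<in> pg_points. P \<subseteq> g ` U}"
      then have "g' ` P \<subseteq> U" using g'g[of U] by (metis image_mono mem_Collect_eq)
      then show "P \<in> ((`) g) ` {P \<in> pg_points. P \<subseteq> U}"
        using P pt' gg'[of P] by (intro image_eqI[of _ _ "g' ` P"]) auto
    qed
  qed (use pt in auto)
  have lineI: "{P \<in> pg_points. P \<subseteq> U} \<in> pg_lines" if "vec.subspace U" "vec.dim U = 1 + 1"
    for U :: "('a ^ 'n) set"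
    unfolding pg_subspaces_def using that by blast
  have lineE: "\<exists>U. vec.subspace U \<and> vec.dim U = 1 + 1 \<and> L = {P \<in> pg_points. P \<subseteq> U}" if "L \<in> pg_lines"
    for L :: "('a ^ 'n) set set"
    using that unfolding pg_subspaces_def by blast
  have "(\<lambda>L. ((`) g) ` L) ` pg_lines = pg_lines"
  proof (intro antisym subsetI)
    fix L' assume "L' \<in> (\<lambda>L. ((`) g) ` L) ` pg_lines"
    then obtain L where L: "L \<in> pg_lines" "L' = ((`) g) ` L" by blast
    then obtain U where U: "vec.subspace U" "vec.dim U = 1 + 1" "L = {P \<in> pg_points. P \<subseteq> U}"
      using lineE by blast
    show "L' \<in> pg_lines"
      unfolding L(2) U(3) line
      by (rule lineI) (simp_all only: vec.linear_subspace_image[OF lin(1) U(1)] dim[OF lin inv(1)] U(2))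
  next
    fix L :: "('a ^ 'n) set set" assume "L \<in> pg_lines"
    then obtain U where U: "vec.subspace U" "vec.dim U = 1 + 1" "L = {P \<in> pg_points. P \<subseteq> U}"
      using lineE by blast
    then have "L = ((`) g) ` {P \<in> pg_points. P \<subseteq> g' ` U}"
      by (simp add: line gg')
    moreover have "{P \<in> pg_points. P \<subseteq> g' ` U} \<in> pg_lines"
      by (rule lineI)
        (simp_all only: vec.linear_subspace_image[OF lin(2) U(1)] dim[OF lin(2,1) inv(2)] U(2))
    ultimately show "L \<in> (\<lambda>L. ((`) g) ` L) ` pg_lines" by blast
  qed
  ultimately show ?thesis by (simp add: pg_collineation_def)
qed

section \<open>The partition of the quadric\<close>

theorem mainTheorem1:
  fixes Q :: "'a::{field,finite} ^ 6 \<Rightarrow> 'a"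
    and p h q :: nat
  assumes "prime p" and "h \<ge> 1" and "q = p ^ h"
    and "[q = 5] (mod 12) \<or> [q = 9] (mod 12)"
    and "CARD('a) = q"
    and "hyperbolic_form5 Q"
  shows "\<exists>\<pi>\<^sub>1 \<pi>\<^sub>2 T\<^sub>1 T\<^sub>2.
           \<pi>\<^sub>1 \<in> generators5 Q \<and> \<pi>\<^sub>2 \<in> generators5 Q \<and>
           tight_set5 Q ((q\<^sup>2 - 1) div 2) T\<^sub>1 \<and> tight_set5 Q ((q\<^sup>2 - 1) div 2) T\<^sub>2 \<and>
           quadric Q = \<pi>\<^sub>1 \<union> \<pi>\<^sub>2 \<union> T\<^sub>1 \<union> T\<^sub>2 \<and>
           \<pi>\<^sub>1 \<inter> \<pi>\<^sub>2 = {} \<and> \<pi>\<^sub>1 \<inter> T\<^sub>1 = {} \<and> \<pi>\<^sub>1 \<inter> T\<^sub>2 = {} \<and>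
           \<pi>\<^sub>2 \<inter> T\<^sub>1 = {} \<and> \<pi>\<^sub>2 \<inter> T\<^sub>2 = {} \<and> T\<^sub>1 \<inter> T\<^sub>2 = {} \<and>
           (\<exists>f. quadric_collineation Q f \<and> f ` T\<^sub>1 = T\<^sub>2)"
proof -
  \<comment> \<open>Both 5 and 9 leave the remainder 1 modulo 4, and 4 divides 12.\<close>
  have "q mod 4 = 1"
    using assms(4) by (auto simp: cong_def) presburger+
  then interpret field_card_1_mod_4 "TYPE('a)"
    by unfold_locales (simp add: assms(5))
  have Q: "quadratic_form Q" using assms(6) by (simp add: hyperbolic_form5_def)
  obtain \<Psi> :: "'a cubic_ext \<Rightarrow> 'a cubic_ext \<Rightarrow> 'a ^ 6" where
    bij: "bij (\<lambda>p. \<Psi> (fst p) (snd p))" and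
    add: "\<And>x y x' y'. \<Psi> (x + x') (y + y') = \<Psi> x y + \<Psi> x' y'" and
    scale: "\<And>c x y. \<Psi> (emb c * x) (emb c * y) = c *s \<Psi> x y" and
    Q\<Psi>: "\<And>x y. Q (\<Psi> x y) = tr (x * y)" and
    dim1: "vec.dim (range (\<lambda>x. \<Psi> x 0)) = 3" and dim2: "vec.dim (range (\<lambda>y. \<Psi> 0 y)) = 3"
    using hyperbolic_form5_coordinates[OF two_F assms(6)] by blast
  have surj: "\<exists>x y. v = \<Psi> x y" for v
    using bij unfolding bij_def surj_def by metis
  have inj: "\<Psi> x y = \<Psi> x' y' \<longleftrightarrow> x = x' \<and> y = y'" for x y x' y'
    using inj_eq[OF bij_is_inj[OF bij], of "(x, y)" "(x', y')"] by simp
  have zero: "\<Psi> 0 0 = 0"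
    using scale[of 0 0 0] by simp
  have polar: "polar_form Q (\<Psi> x y) (\<Psi> x' y') = tr (x * y' + x' * y)" for x y x' y'
    unfolding polar_form_def add[symmetric] Q\<Psi>
    by (simp add: tr_add distrib_left distrib_right)
  define \<pi>1 where "\<pi>1 = {P \<in> pg_points. P \<subseteq> range (\<lambda>x. \<Psi> x 0)}"
  define \<pi>2 where "\<pi>2 = {P \<in> pg_points. P \<subseteq> range (\<lambda>y. \<Psi> 0 y)}"
  define S where "S s = {\<Psi> x y | x y. pair_sign x y = s}" for s
  \<comment> \<open>The zero vector is taken out because its sign is 0, while the levels of interest
    are 1 and -1.\<close>
  define T where "T s = {P \<in> pg_points. P - {0} \<subseteq> S s}" for s
  \<comment> \<open>Membership of a point in the quadric and in each of the four parts is tested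
    below on any nonzero representative pair.\<close>
  have point: "\<exists>x y. \<Psi> x y \<in> P \<and> (x \<noteq> 0 \<or> y \<noteq> 0)" if P: "P \<in> pg_points" for P
  proof -
    obtain v where v: "v \<in> P" "v \<noteq> 0" by (rule pg_point_nonzero[OF P])
    obtain x y where xy: "v = \<Psi> x y" using surj by blast
    then have "x \<noteq> 0 \<or> y \<noteq> 0" using v(2) zero by auto
    with v(1) xy show ?thesis by blast
  qed
  have nonzero: "\<Psi> x y \<noteq> 0" if "x \<noteq> 0 \<or> y \<noteq> 0" for x y
    using that inj[of x y 0 0] zero by simp
  have eq: "P = range (\<lambda>c. \<Psi> (emb c * x) (emb c * y))"
    if "P \<in> pg_points" "\<Psi> x y \<in> P" "x \<noteq> 0 \<or> y \<noteq> 0" for P x y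
    using pg_point_eq_range[OF that(1,2) nonzero[OF that(3)]] by (simp add: scale)
  have in_quadric: "P \<in> quadric Q \<longleftrightarrow> tr (x * y) = 0"
    if "P \<in> pg_points" "\<Psi> x y \<in> P" "x \<noteq> 0 \<or> y \<noteq> 0" for P x y
    using quadric_iff[OF Q that(1,2) nonzero[OF that(3)]] by (simp add: Q\<Psi>)
  have in_1: "P \<in> \<pi>1 \<longleftrightarrow> y = 0"
    if P: "P \<in> pg_points" "\<Psi> x y \<in> P" "x \<noteq> 0 \<or> y \<noteq> 0" for P x y
  proof
    assume "P \<in> \<pi>1"
    then show "y = 0" using P(2) by (auto simp: \<pi>1_def inj)
  next
    assume "y = 0"
    then have "P \<subseteq> range (\<lambda>x. \<Psi> x 0)" by (subst eq[OF P]) auto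
    then show "P \<in> \<pi>1" using P(1) by (simp add: \<pi>1_def)
  qed
  have in_2: "P \<in> \<pi>2 \<longleftrightarrow> x = 0"
    if P: "P \<in> pg_points" "\<Psi> x y \<in> P" "x \<noteq> 0 \<or> y \<noteq> 0" for P x y
  proof
    assume "P \<in> \<pi>2"
    then show "x = 0" using P(2) by (auto simp: \<pi>2_def inj)
  next
    assume "x = 0"
    then have "P \<subseteq> range (\<lambda>y. \<Psi> 0 y)" by (subst eq[OF P]) auto
    then show "P \<in> \<pi>2" using P(1) by (simp add: \<pi>2_def)
  qed
  have in_T: "P \<in> T s \<longleftrightarrow> pair_sign x y = s"
    if P: "P \<in> pg_points" "\<Psi> x y \<in> P" "x \<noteq> 0 \<or> y \<noteq> 0" for P x y s
  proof
    assume "P \<in> T s"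
    then have "\<Psi> x y \<in> S s" using P(2) nonzero[OF P(3)] by (auto simp: T_def)
    then show "pair_sign x y = s" by (auto simp: S_def inj)
  next
    assume s: "pair_sign x y = s"
    have "\<Psi> (emb c * x) (emb c * y) \<in> S s" if "\<Psi> (emb c * x) (emb c * y) \<noteq> 0" for c
    proof -
      have "c \<noteq> 0" using that zero by auto
      then show ?thesis using s pair_sign_scale unfolding S_def by blast
    qed
    then have "P - {0} \<subseteq> S s" by (subst eq[OF P]) auto
    then show "P \<in> T s" using P(1) by (simp add: T_def)
  qed
  have points: "quadric Q \<subseteq> pg_points" "\<pi>1 \<subseteq> pg_points" "\<pi>2 \<subseteq> pg_points" "T s \<subseteq> pg_points" for s
    by (auto simp: quadric_def \<pi>1_def \<pi>2_def T_def)
  have sub: "A \<subseteq> quadric Q" if A: "A \<subseteq> pg_points"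
    and tr: "\<And>P x y. P \<in> pg_points \<Longrightarrow> \<Psi> x y \<in> P \<Longrightarrow> x \<noteq> 0 \<or> y \<noteq> 0 \<Longrightarrow> P \<in> A \<Longrightarrow> tr (x * y) = 0" for A
  proof
    fix P assume P: "P \<in> A"
    then have P': "P \<in> pg_points" using A by blast
    then obtain x y where xy: "\<Psi> x y \<in> P" "x \<noteq> 0 \<or> y \<noteq> 0" using point by blast
    show "P \<in> quadric Q" using in_quadric[OF P' xy] tr[OF P' xy P] by simp
  qed
  have sub1: "\<pi>1 \<subseteq> quadric Q"
    by (rule sub[OF points(2)]) (simp add: in_1)
  have sub2: "\<pi>2 \<subseteq> quadric Q"
    by (rule sub[OF points(3)]) (simp add: in_2)
  have subT: "T s \<subseteq> quadric Q" if s: "s = 1 \<or> s = - 1" for s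
  proof (rule sub[OF points(4)])
    fix P x y assume "P \<in> pg_points" "\<Psi> x y \<in> P" "x \<noteq> 0 \<or> y \<noteq> 0" "P \<in> T s"
    then have "pair_sign x y = s" by (simp add: in_T)
    then show "tr (x * y) = 0" using s pair_sign_eq_0_iff[of x y] by auto
  qed

  \<comment> \<open>The two generators\<close>
  have gen1: "\<pi>1 \<in> generators5 Q"
  proof -
    have "0 \<in> range (\<lambda>x. \<Psi> x 0)"
      by (rule image_eqI[of _ _ 0]) (simp_all add: zero)
    moreover have "\<Psi> x 0 + \<Psi> x' 0 = \<Psi> (x + x') 0" for x x'
      using add[of x x' 0 0] by simp
    moreover have "c *s \<Psi> x 0 = \<Psi> (emb c * x) 0" for c x
      using scale[of c x 0] by simp
    ultimately have "vec.subspace (range (\<lambda>x. \<Psi> x 0))"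
      by (auto simp: vec.subspace_def)
    then have "\<pi>1 \<in> pg_planes"
      unfolding pg_subspaces_def \<pi>1_def using dim1 by auto
    with sub1 show ?thesis by (simp add: generators5_def)
  qed
  have gen2: "\<pi>2 \<in> generators5 Q"
  proof -
    have "0 \<in> range (\<lambda>y. \<Psi> 0 y)"
      by (rule image_eqI[of _ _ 0]) (simp_all add: zero)
    moreover have "\<Psi> 0 y + \<Psi> 0 y' = \<Psi> 0 (y + y')" for y y'
      using add[of 0 0 y y'] by simp
    moreover have "c *s \<Psi> 0 y = \<Psi> 0 (emb c * y)" for c y
      using scale[of c 0 y] by simp
    ultimately have "vec.subspace (range (\<lambda>y. \<Psi> 0 y))"
      by (auto simp: vec.subspace_def)
    then have "\<pi>2 \<in> pg_planes"
      unfolding pg_subspaces_def \<pi>2_def using dim2 by auto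
    with sub2 show ?thesis by (simp add: generators5_def)
  qed

  \<comment> \<open>Tightness of the level sets\<close>
  have tight: "tight_set5 Q ((q\<^sup>2 - 1) div 2) (T s)" if s: "s = 1 \<or> s = - 1" for s
    unfolding tight_set5_def
  proof (intro conjI ballI)
    show "T s \<subseteq> quadric Q" by (rule subT[OF s])
    fix P assume P: "P \<in> quadric Q"
    then have P': "P \<in> pg_points" using points by blast
    then obtain x0 y0 where xy0: "\<Psi> x0 y0 \<in> P" "x0 \<noteq> 0 \<or> y0 \<noteq> 0" using point by blast
    have tr0: "tr (x0 * y0) = 0" using in_quadric[OF P' xy0] P by simp
    \<comment> \<open>The nonzero vectors over the points of \<open>T s\<close> collinear with P, a
      cone to which the vector count applies.\<close>
    define S' where "S' = {\<Psi> x y | x y. pair_sign x y = s \<and> tr (x0 * y + x * y0) = 0}"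
    have "quadric_perp Q P \<inter> T s = {R \<in> pg_points. R - {0} \<subseteq> S'}"
    proof (intro antisym subsetI)
      fix R assume R: "R \<in> quadric_perp Q P \<inter> T s"
      then have R': "R \<in> pg_points" "R \<in> quadric Q" using points subT[OF s] by blast+
      have "v \<in> S'" if v: "v \<in> R" "v \<noteq> 0" for v
      proof -
        obtain x y where xy: "v = \<Psi> x y" using surj by blast
        then have nz: "x \<noteq> 0 \<or> y \<noteq> 0" using v(2) zero by auto
        have "pair_sign x y = s" using in_T[OF R'(1) _ nz] R v xy by auto
        moreover have "tr (x0 * y + x * y0) = 0"
          using quadric_perp_iff[OF Q P xy0(1) nonzero[OF xy0(2)] R'(2) v] R by (simp add: xy polar)
        ultimately show ?thesis unfolding S'_def xy by blast
      qed
      then show "R \<in> {R \<in> pg_points. R - {0} \<subseteq> S'}" using R' by blast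
    next
      fix R assume R: "R \<in> {R \<in> pg_points. R - {0} \<subseteq> S'}"
      moreover have "S' \<subseteq> S s" by (auto simp: S_def S'_def)
      ultimately have RT: "R \<in> T s" unfolding T_def by blast
      have R': "R \<in> pg_points" "R \<in> quadric Q" using R RT subT[OF s] by auto
      obtain x y where xy: "\<Psi> x y \<in> R" "x \<noteq> 0 \<or> y \<noteq> 0" using point[OF R'(1)] by blast
      then have "\<Psi> x y \<in> S'" using R nonzero[OF xy(2)] by auto
      then have "tr (x0 * y + x * y0) = 0" by (auto simp: S'_def inj)
      then have "R \<in> quadric_perp Q P"
        using quadric_perp_iff[OF Q P xy0(1) nonzero[OF xy0(2)] R'(2) xy(1) nonzero[OF xy(2)]]
        by (simp add: polar)
      with RT show "R \<in> quadric_perp Q P \<inter> T s" by blast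
    qed
    moreover have "card S' = (CARD('a) - 1) * card {R \<in> pg_points. R - {0} \<subseteq> S'}"
    proof (rule card_pg_points_of_cone)
      show "0 \<notin> S'"
      proof
        assume "0 \<in> S'"
        then have "pair_sign 0 0 = s" using inj[of 0 0] zero by (auto simp: S'_def)
        then show False using s pair_sign_eq_0_iff[of 0 0] by auto
      qed
      fix c :: 'a and v assume c: "c \<noteq> 0" and "v \<in> S'"
      then obtain x y where v: "v = \<Psi> x y" "pair_sign x y = s" "tr (x0 * y + x * y0) = 0"
        by (auto simp: S'_def)
      have "x0 * (emb c * y) + emb c * x * y0 = emb c * (x0 * y + x * y0)"
        by (simp add: algebra_simps)
      then have "tr (x0 * (emb c * y) + emb c * x * y0) = 0"
        using v(3) by (simp only: tr_scale mult_zero_right)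
      moreover have "pair_sign (emb c * x) (emb c * y) = s"
        using pair_sign_scale[OF c] v(2) by simp
      ultimately show "c *s v \<in> S'"
        unfolding v(1) scale[symmetric] S'_def by blast
    qed
    moreover have "card S' = card {(x, y). pair_sign x y = s \<and> tr (x0 * y + x * y0) = 0}"
    proof -
      have "S' = (\<lambda>p. \<Psi> (fst p) (snd p)) ` {(x, y). pair_sign x y = s \<and> tr (x0 * y + x * y0) = 0}"
        by (auto simp: S'_def image_iff) blast+
      then show ?thesis
        by (simp add: card_image inj_on_subset[OF bij_is_inj[OF bij]])
    qed
    ultimately have "(CARD('a) - 1) * card (quadric_perp Q P \<inter> T s) = (CARD('a) - 1) *
        ((CARD('a)\<^sup>2 - 1) div 2 * (CARD('a) + 1) + CARD('a)\<^sup>2 * of_bool (pair_sign x0 y0 = s))"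
      using card_pair_sign_perp[OF xy0(2) tr0 s] by metis
    moreover have "CARD('a) - 1 \<noteq> 0" using card_field_ge_2[where 'a='a] by simp
    ultimately show "card (quadric_perp Q P \<inter> T s) =
        (q\<^sup>2 - 1) div 2 * (CARD('a) + 1) + CARD('a)\<^sup>2 * of_bool (P \<in> T s)"
      unfolding assms(5)[symmetric] in_T[OF P' xy0, of s] by (simp only: Nat.mult_cancel1 simp_thms)
  qed

  \<comment> \<open>The isometry exchanging the two level sets\<close>
  define g where "g v = (let p = inv_into UNIV (\<lambda>p. \<Psi> (fst p) (snd p)) v in
    \<Psi> (emb nonsq * fst p) (snd p / emb nonsq))" for v
  define g' where "g' v = (let p = inv_into UNIV (\<lambda>p. \<Psi> (fst p) (snd p)) v in
    \<Psi> (fst p / emb nonsq) (emb nonsq * snd p))" for v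
  have inv\<Psi>: "inv_into UNIV (\<lambda>p. \<Psi> (fst p) (snd p)) (\<Psi> x y) = (x, y)" for x y
    using inv_into_f_f[OF bij_is_inj[OF bij], of "(x, y)"] by simp
  have g\<Psi>: "g (\<Psi> x y) = \<Psi> (emb nonsq * x) (y / emb nonsq)"
    and g'\<Psi>: "g' (\<Psi> x y) = \<Psi> (x / emb nonsq) (emb nonsq * y)" for x y
    by (simp_all add: g_def g'_def inv\<Psi>)
  have lin: "Vector_Spaces.linear (*s) (*s) g" "Vector_Spaces.linear (*s) (*s) g'"
  proof -
    have "g (v + w) = g v + g w" "g' (v + w) = g' v + g' w" "g (c *s v) = c *s g v" "g' (c *s v) = c *s g' v" for v w c
    proof -
      obtain x y x' y' where v: "v = \<Psi> x y" and w: "w = \<Psi> x' y'" using surj by metis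
      show "g (v + w) = g v + g w" "g' (v + w) = g' v + g' w"
        unfolding v w add[symmetric] g\<Psi> g'\<Psi> by (simp_all add: distrib_left add_divide_distrib)
      show "g (c *s v) = c *s g v" "g' (c *s v) = c *s g' v"
        unfolding v scale[symmetric] g\<Psi> g'\<Psi> by (simp_all add: mult.left_commute)
    qed
    then show "Vector_Spaces.linear (*s) (*s) g" "Vector_Spaces.linear (*s) (*s) g'"
      by (simp_all add: Vector_Spaces.linear_iff vec.vector_space_axioms)
  qed
  have inv: "g' (g v) = v" "g (g' v) = v" for v
  proof -
    obtain x y where v: "v = \<Psi> x y" using surj by metis
    show "g' (g v) = v" "g (g' v) = v"
      using nonsq_nonzero by (simp_all add: v g\<Psi> g'\<Psi>)
  qed
  have coll: "pg_collineation ((`) g)"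
    by (rule pg_collineation_of_linear[OF lin inv])
  \<comment> \<open>Reduces the image of a set of points under g to a comparison on representative
    pairs.\<close>
  have image: "((`) g) ` {P \<in> pg_points. C P} = {P \<in> pg_points. D P}"
    if CD: "\<And>P x y. P \<in> pg_points \<Longrightarrow> \<Psi> x y \<in> P \<Longrightarrow> x \<noteq> 0 \<or> y \<noteq> 0 \<Longrightarrow> C P \<longleftrightarrow> D (g ` P)" for C D
  proof -
    have CD': "C P \<longleftrightarrow> D (g ` P)" if "P \<in> pg_points" for P
      using CD that point[OF that] by blast
    have pts: "((`) g) ` pg_points = pg_points"
      using coll by (simp add: pg_collineation_def bij_betw_def)
    show ?thesis
    proof (intro antisym subsetI)
      fix R assume "R \<in> ((`) g) ` {P \<in> pg_points. C P}"
      then obtain P where P: "P \<in> pg_points" "C P" "R = g ` P" by auto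
      then have "R \<in> pg_points" using imageI[of P pg_points "(`) g"] pts by simp
      then show "R \<in> {P \<in> pg_points. D P}" using P CD' by simp
    next
      fix R assume R: "R \<in> {P \<in> pg_points. D P}"
      then have "R \<in> ((`) g) ` pg_points" unfolding pts by simp
      then obtain P where P: "P \<in> pg_points" "R = g ` P" by auto
      then show "R \<in> ((`) g) ` {P \<in> pg_points. C P}" using R CD' by simp
    qed
  qed
  have gP: "g ` P \<in> pg_points \<and> \<Psi> (emb nonsq * x) (y / emb nonsq) \<in> g ` P \<and>
      (emb nonsq * x \<noteq> 0 \<or> y / emb nonsq \<noteq> 0)"
    if "P \<in> pg_points" "\<Psi> x y \<in> P" "x \<noteq> 0 \<or> y \<noteq> 0" for P x y
    using that coll nonsq_nonzero imageI[OF that(2), of g]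
    by (auto simp: pg_collineation_def bij_betw_def g\<Psi>)
  have "((`) g) ` {P \<in> pg_points. P \<in> quadric Q} = {P \<in> pg_points. P \<in> quadric Q}"
  proof (rule image)
    fix P x y assume P: "P \<in> pg_points" "\<Psi> x y \<in> P" "x \<noteq> 0 \<or> y \<noteq> 0"
    then show "P \<in> quadric Q \<longleftrightarrow> g ` P \<in> quadric Q"
      using in_quadric[OF P] in_quadric[of "g ` P" "emb nonsq * x" "y / emb nonsq"] gP[OF P] nonsq_nonzero
      by simp
  qed
  moreover have "{P \<in> pg_points. P \<in> quadric Q} = quadric Q" using points by blast
  ultimately have "quadric_collineation Q ((`) g)"
    using coll by (simp add: quadric_collineation_def)
  moreover have "((`) g) ` {P \<in> pg_points. P \<in> T 1} = {P \<in> pg_points. P \<in> T (- 1)}"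
  proof (rule image)
    fix P x y assume P: "P \<in> pg_points" "\<Psi> x y \<in> P" "x \<noteq> 0 \<or> y \<noteq> 0"
    then show "P \<in> T 1 \<longleftrightarrow> g ` P \<in> T (- 1)"
      using in_T[OF P] in_T[of "g ` P" "emb nonsq * x" "y / emb nonsq"] gP[OF P]
      by (simp add: pair_sign_swap)
  qed
  moreover have "{P \<in> pg_points. P \<in> T s} = T s" for s using points by blast
  ultimately have iso: "\<exists>f. quadric_collineation Q f \<and> f ` T 1 = T (- 1)"
    by (intro exI[of _ "(`) g"]) simp

  \<comment> \<open>Cover and disjointness\<close>
  have "quadric Q \<subseteq> \<pi>1 \<union> \<pi>2 \<union> T 1 \<union> T (- 1)"
  proof
    fix P assume P: "P \<in> quadric Q"
    then have P': "P \<in> pg_points" using points by blast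
    then obtain x y where xy: "\<Psi> x y \<in> P" "x \<noteq> 0 \<or> y \<noteq> 0" using point by blast
    have "tr (x * y) = 0" using in_quadric[OF P' xy] P by simp
    then show "P \<in> \<pi>1 \<union> \<pi>2 \<union> T 1 \<union> T (- 1)"
      using in_1[OF P' xy] in_2[OF P' xy] in_T[OF P' xy] pair_sign_cases[of x y] by auto
  qed
  then have cover: "quadric Q = \<pi>1 \<union> \<pi>2 \<union> T 1 \<union> T (- 1)"
    using sub1 sub2 subT[of 1] subT[of "- 1"] by auto
  have disj: "A \<inter> B = {}" if "A \<subseteq> pg_points"
    "\<And>P x y. P \<in> pg_points \<Longrightarrow> \<Psi> x y \<in> P \<Longrightarrow> x \<noteq> 0 \<or> y \<noteq> 0 \<Longrightarrow> P \<in> A \<Longrightarrow> P \<in> B \<Longrightarrow> False" for A B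
    using that point by blast
  have d12: "\<pi>1 \<inter> \<pi>2 = {}"
    by (rule disj[OF points(2)]) (simp add: in_1 in_2)
  have d1T: "\<pi>1 \<inter> T s = {}" if "s = 1 \<or> s = - 1" for s
  proof (rule disj[OF points(2)])
    fix P x y assume "P \<in> pg_points" "\<Psi> x y \<in> P" "x \<noteq> 0 \<or> y \<noteq> 0" "P \<in> \<pi>1" "P \<in> T s"
    then have "y = 0" "pair_sign x y = s" by (simp_all add: in_1 in_T)
    then show False using that pair_sign_eq_0_iff[of x y] by auto
  qed
  have d2T: "\<pi>2 \<inter> T s = {}" if "s = 1 \<or> s = - 1" for s
  proof (rule disj[OF points(3)])
    fix P x y assume "P \<in> pg_points" "\<Psi> x y \<in> P" "x \<noteq> 0 \<or> y \<noteq> 0" "P \<in> \<pi>2" "P \<in> T s"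
    then have "x = 0" "pair_sign x y = s" by (simp_all add: in_2 in_T)
    then show False using that pair_sign_eq_0_iff[of x y] by auto
  qed
  have dTT: "T 1 \<inter> T (- 1) = {}"
    by (rule disj[OF points(4)]) (simp add: in_T)
  show ?thesis
    by (rule exI[of _ \<pi>1], rule exI[of _ \<pi>2], rule exI[of _ "T 1"], rule exI[of _ "T (- 1)"],
        intro conjI gen1 gen2 tight cover d12 d1T d2T dTT iso) simp_all
qed

end
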